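(* There is an absolute constant $C>0$ such that for every integer $N \geq 3$ and every set $A \subset \{1,\dots,N\}$ containing no non-trivial three-term arithmetic progressions, $$|A| \leq C\,\frac{N(\log\log N)^5}{\log N}.$$
   Context: A non-trivial three-term arithmetic progression in $A$ is a triple $(x,x+r,x+2r)$ of elements of $A$ with $r \neq 0$. *)

theory Defs
  imports Complex_Main
begin

definition nontrivial_3ap_in :: "int set \<Rightarrow> int \<times> int \<times> int \<Rightarrow> bool" where
  "nontrivial_3ap_in A t \<longleftrightarrow>
     (\<exists>x r. t = (x, x + r, x + 2 * r) \<and> r \<noteq> 0 \<and> x \<in> A \<and> x + r \<in> A \<and> x + 2 * r \<in> A)"

definition ap3_free :: "int set \<Rightarrow> bool" where
  "ap3_free A \<longleftrightarrow> (\<nexists>t. nontrivial_3ap_in A t)"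

end

theory Submission
  imports Defs "HOL-Analysis.Analysis"
begin

text \<open>
  The proof is a density increment on Bohr sets. Let \<open>A\<close> have density \<open>\<alpha>\<close> on a regular Bohr set and contain no
  non-trivial three-term progression. On a slightly smaller Bohr set \<open>B\<close>, let \<open>f\<close> be the indicator function of \<open>A\<close>
  minus its density, and let \<open>A2\<close> be the part of \<open>A\<close> in a much narrower Bohr set, from which the middle terms are
  taken. The expected number of progressions is missing, and so the sum over frequencies \<open>\<theta>\<close> of
  \<open>\<bar>f^(\<theta>)\<bar>\<^sup>2 * \<bar>A2^(2 \<theta>)\<bar>\<close> is large (\<open>progression_free_fourier_mass\<close>). Viewing \<open>\<bar>f^\<bar>\<^sup>2\<close>, normalised, as a probability
  distribution on frequencies, \<open>A2\<close> correlates to degree \<open>\<eta> \<ge> \<alpha> / 2\<close> with a random frequency.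

  The heart of the proof (\<open>concentrated_near_few_frequencies\<close>), an idea of Bloom, is that this distribution must
  have mass at least \<open>\<eta> / 18\<close> near the \<open>{-1, 0, 1}\<close>-span of only \<open>O(\<eta>^-1 log (1 / \<alpha>))\<close> frequencies. Sample that
  many frequencies at random. High moments (\<open>moment_expansion\<close>) show that a signed sum of \<open>2 m\<close> of them, with
  \<open>m\<close> about \<open>log (1 / \<alpha>)\<close>, nearly vanishes with probability about \<open>\<eta>^(2 m)\<close>; the samples are numerous enough for the
  expected number of such relations to be exponential in \<open>m\<close>. On the other hand a relation is determined by those of
  its terms that are nearly spanned by earlier samples (\<open>relations_inject_into_spanned_positions\<close>). If all
  spans had small mass, these would be rare, and there would be too few relations.

  Adjoining the spanning frequencies to the Bohr set makes a constant proportion of the missing mass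
  visible on the new Bohr set, and an \<open>L\<^sup>2\<close> argument (\<open>fourier_mass_density_increment\<close>) gives a translate of a dilate on which
  the density of \<open>A\<close> is larger by a constant factor. So there are only \<open>O(log (1 / \<alpha>))\<close> steps; each raises the rank by
  \<open>O(\<alpha>^-1 log (1 / \<alpha>))\<close> and divides the radius by a power of \<open>1 / \<alpha>\<close>. A Bohr set of rank \<open>d\<close> and radius \<open>r\<close> in an
  interval of length \<open>N\<close> has at least \<open>N * r^O(d + 1)\<close> elements. The iteration has to break down before the density
  exceeds 1, so the Bohr sets must have become tiny, which requires \<open>log N = O(\<alpha>^-1 log (1 / \<alpha>)^4)\<close>.
  For \<open>\<alpha> \<ge> 1 / log N\<close> this means \<open>\<alpha> = O((log log N)^4 / log N)\<close>.
\<close>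

section \<open>Bohr sets of integers\<close>

text \<open>
  A frequency is an angle \<open>\<theta>\<close>, standing for the character \<open>x \<mapsto> cis (\<theta> x)\<close> of the integers. The
  condition on \<open>\<bar>x\<bar>\<close> makes these sets finite and behaves like one more frequency, so a single
  radius \<open>\<rho>\<close> controls everything and \<open>bohr N {} \<rho>\<close> is an interval.
\<close>

definition bohr :: "real \<Rightarrow> real set \<Rightarrow> real \<Rightarrow> int set" where
  "bohr N \<Lambda> \<rho> = {x. \<bar>real_of_int x\<bar> \<le> \<rho> * N \<and> (\<forall>\<theta>\<in>\<Lambda>. cmod (cis (\<theta> * x) - 1) \<le> \<rho>)}"

lemma finite_bounded_ints: "finite {x::int. \<bar>real_of_int x\<bar> \<le> c}"
proof (rule finite_subset)
  show "{x::int. \<bar>real_of_int x\<bar> \<le> c} \<subseteq> {-\<lceil>c\<rceil>..\<lceil>c\<rceil>}"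
    by (auto simp: abs_le_iff) linarith+
qed auto

lemma finite_bohr [simp]: "finite (bohr N \<Lambda> \<rho>)"
  by (rule finite_subset[OF _ finite_bounded_ints[of "\<rho> * N"]]) (auto simp: bohr_def)

lemma zero_in_bohr: "\<rho> \<ge> 0 \<Longrightarrow> N \<ge> 0 \<Longrightarrow> 0 \<in> bohr N \<Lambda> \<rho>"
  by (auto simp: bohr_def)

lemma card_bohr_pos: "\<rho> \<ge> 0 \<Longrightarrow> N \<ge> 0 \<Longrightarrow> card (bohr N \<Lambda> \<rho>) > 0"
  using zero_in_bohr[of \<rho> N \<Lambda>] by (auto simp: card_gt_0_iff)

lemma cmod_cis_diff: "cmod (cis a - cis b) = cmod (cis (a - b) - 1)"
proof -
  have "cis a - cis b = cis b * (cis (a - b) - 1)"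
    by (simp add: right_diff_distrib cis_mult)
  then show ?thesis by (simp add: norm_mult)
qed

lemma cmod_cis_minus: "cmod (cis (- a) - 1) = cmod (cis a - 1)"
  using cmod_cis_diff[of 0 a] by (simp add: norm_minus_commute)

lemma cmod_cis_add: "cmod (cis (a + b) - 1) \<le> cmod (cis a - 1) + cmod (cis b - 1)"
proof -
  have "cmod (cis (a + b) - 1) \<le> cmod (cis (a + b) - cis b) + cmod (cis b - 1)"
    using norm_triangle_ineq[of "cis (a + b) - cis b" "cis b - 1"] by simp
  then show ?thesis by (simp add: cmod_cis_diff)
qed

lemma bohr_uminus: "x \<in> bohr N \<Lambda> \<rho> \<Longrightarrow> - x \<in> bohr N \<Lambda> \<rho>"
  by (auto simp: bohr_def cmod_cis_minus)

lemma bohr_add: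
  assumes "x \<in> bohr N \<Lambda> \<rho>" "y \<in> bohr N \<Lambda> \<sigma>"
  shows "x + y \<in> bohr N \<Lambda> (\<rho> + \<sigma>)"
proof -
  have "cmod (cis (\<theta> * (x + y)) - 1) \<le> \<rho> + \<sigma>" if "\<theta> \<in> \<Lambda>" for \<theta>
    using assms that cmod_cis_add[of "\<theta> * x" "\<theta> * y"]
    by (fastforce simp: bohr_def distrib_left)
  then show ?thesis using assms
    by (auto simp: bohr_def distrib_right)
qed

lemma bohr_diff:
  assumes "x \<in> bohr N \<Lambda> \<rho>" "y \<in> bohr N \<Lambda> \<sigma>"
  shows "x - y \<in> bohr N \<Lambda> (\<rho> + \<sigma>)"
  using bohr_add[OF assms(1) bohr_uminus[OF assms(2)]] by simp

lemma bohr_mono: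
  assumes "\<rho> \<le> \<sigma>" "N \<ge> 0" "\<Lambda>' \<subseteq> \<Lambda>"
  shows "bohr N \<Lambda> \<rho> \<subseteq> bohr N \<Lambda>' \<sigma>"
proof -
  have "\<rho> * N \<le> \<sigma> * N" using assms by (simp add: mult_right_mono)
  then show ?thesis using assms by (fastforce simp: bohr_def)
qed

lemma card_bohr_mono: "\<rho> \<le> \<sigma> \<Longrightarrow> N \<ge> 0 \<Longrightarrow> card (bohr N \<Lambda> \<rho>) \<le> card (bohr N \<Lambda> \<sigma>)"
  by (intro card_mono bohr_mono) auto

text \<open>
  The disc of radius \<open>2 \<rho>\<close> is covered by a grid of \<open>9 \<times> 9\<close> squares of side \<open>\<rho> / 2\<close>, and two points of
  one square are at distance at most \<open>\<rho>\<close>.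
\<close>

lemma pigeonhole_small_cell:
  fixes g :: "int \<Rightarrow> complex"
  assumes X: "finite X" and \<rho>: "\<rho> > 0" and g: "\<And>x. x \<in> X \<Longrightarrow> cmod (g x - z) \<le> 2 * \<rho>"
  obtains Y where "Y \<subseteq> X" "card X \<le> 81 * card Y"
    "\<And>x y. x \<in> Y \<Longrightarrow> y \<in> Y \<Longrightarrow> cmod (g x - g y) \<le> \<rho>"
proof -
  \<comment> \<open>The index of the strip of width \<open>\<rho> / 2\<close> containing the coordinate w.\<close>
  define u where "u w = \<lfloor>(w + 2 * \<rho>) / (\<rho> / 2)\<rfloor>" for w :: real
  have u_range: "u w \<in> {0..8}" if "\<bar>w\<bar> \<le> 2 * \<rho>" for w
  proof -
    have "0 \<le> (w + 2 * \<rho>) / (\<rho> / 2)" "(w + 2 * \<rho>) / (\<rho> / 2) \<le> 8"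
      using that \<rho> by (auto simp: field_simps)
    then show ?thesis unfolding u_def by (auto simp: floor_le_iff)
  qed
  have u_close: "\<bar>v - w\<bar> \<le> \<rho> / 2" if "u v = u w" for v w
  proof -
    have "\<bar>(v + 2 * \<rho>) / (\<rho> / 2) - (w + 2 * \<rho>) / (\<rho> / 2)\<bar> \<le> 1"
      using that unfolding u_def by linarith
    also have "(v + 2 * \<rho>) / (\<rho> / 2) - (w + 2 * \<rho>) / (\<rho> / 2) = (v - w) / (\<rho> / 2)"
      by (simp add: diff_divide_distrib [symmetric])
    finally have "\<bar>v - w\<bar> / (\<rho> / 2) \<le> 1" using \<rho> by (simp only: abs_divide)
    then have "\<bar>v - w\<bar> / (\<rho> / 2) * (\<rho> / 2) \<le> 1 * (\<rho> / 2)"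
      using \<rho> by (intro mult_right_mono) auto
    then show ?thesis using \<rho> by simp
  qed
  define cell where "cell x = (u (Re (g x - z)), u (Im (g x - z)))" for x
  define C where "C = {0..8::int} \<times> {0..8::int}"
  have cell: "cell x \<in> C" if "x \<in> X" for x
    unfolding C_def cell_def mem_Times_iff fst_conv snd_conv
    using abs_Re_le_cmod[of "g x - z"] abs_Im_le_cmod[of "g x - z"] g[OF that]
    by (intro conjI u_range) linarith+
  have cardC: "card C = 81" and finC: "finite C" by (auto simp: C_def)
  have "\<exists>c\<in>C. card X \<le> 81 * card {x\<in>X. cell x = c}"
  proof (rule ccontr)
    assume "\<not> ?thesis"
    then have small: "81 * card {x\<in>X. cell x = c} < card X" if "c \<in> C" for c
      using that by (meson not_le)
    have "X = (\<Union>c\<in>C. {x\<in>X. cell x = c})" using cell by auto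
    then have "card X \<le> (\<Sum>c\<in>C. card {x\<in>X. cell x = c})"
      using card_UN_le[OF finC] by metis
    then have "81 * card X \<le> (\<Sum>c\<in>C. 81 * card {x\<in>X. cell x = c})"
      by (simp add: sum_distrib_left [symmetric])
    also have "\<dots> < (\<Sum>c\<in>C. card X)"
      using small cardC finC by (intro sum_strict_mono) auto
    also have "\<dots> = 81 * card X" by (simp add: cardC)
    finally show False by simp
  qed
  then obtain c where c: "card X \<le> 81 * card {x\<in>X. cell x = c}" by blast
  show thesis
  proof (rule that[of "{x\<in>X. cell x = c}"])
    fix x y assume "x \<in> {x\<in>X. cell x = c}" "y \<in> {x\<in>X. cell x = c}"
    then have "cell x = cell y" by simp
    then have "\<bar>Re (g x - z) - Re (g y - z)\<bar> \<le> \<rho> / 2" "\<bar>Im (g x - z) - Im (g y - z)\<bar> \<le> \<rho> / 2"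
      using u_close[of "Re (g x - z)" "Re (g y - z)"] u_close[of "Im (g x - z)" "Im (g y - z)"]
      by (auto simp: cell_def)
    then show "cmod (g x - g y) \<le> \<rho>"
      using cmod_le[of "g x - g y"] by simp
  qed (use c in auto)
qed

text \<open>
  One application of the pigeonhole per frequency, and one for the interval, leaves a set all of
  whose differences lie in the Bohr set of half the radius.
\<close>

lemma bohr_doubling:
  assumes fin: "finite \<Lambda>" and \<rho>: "\<rho> > 0" and N: "N > 0"
  shows "card (bohr N \<Lambda> (2 * \<rho>)) \<le> 81 ^ (card \<Lambda> + 1) * card (bohr N \<Lambda> \<rho>)"
proof -
  define X where "X = bohr N \<Lambda> (2 * \<rho>)"
  have "\<exists>Y\<subseteq>X. card X \<le> 81 ^ card \<Lambda>' * card Y \<and>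
      (\<forall>\<theta>\<in>\<Lambda>'. \<forall>x\<in>Y. \<forall>y\<in>Y. cmod (cis (\<theta> * x) - cis (\<theta> * y)) \<le> \<rho>)"
    if "finite \<Lambda>'" "\<Lambda>' \<subseteq> \<Lambda>" for \<Lambda>'
    using that
  proof (induction \<Lambda>' rule: finite_induct)
    case empty
    show ?case by (rule exI[of _ X]) auto
  next
    case (insert \<theta> F)
    from insert.IH insert.prems
    obtain Y where Y: "Y \<subseteq> X" "card X \<le> 81 ^ card F * card Y"
      "\<forall>\<theta>\<in>F. \<forall>x\<in>Y. \<forall>y\<in>Y. cmod (cis (\<theta> * x) - cis (\<theta> * y)) \<le> \<rho>" by blast
    have finY: "finite Y" using Y(1) unfolding X_def by (rule finite_subset) simp
    have "cmod (cis (\<theta> * x) - 1) \<le> 2 * \<rho>" if "x \<in> Y" for x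
      using that Y(1) insert.prems by (auto simp: X_def bohr_def)
    from pigeonhole_small_cell[of Y \<rho> "\<lambda>x. cis (\<theta> * x)" 1, OF finY \<rho> this]
    obtain Z where Z: "Z \<subseteq> Y" "card Y \<le> 81 * card Z"
      "\<And>x y. x \<in> Z \<Longrightarrow> y \<in> Z \<Longrightarrow> cmod (cis (\<theta> * x) - cis (\<theta> * y)) \<le> \<rho>" by blast
    have "card X \<le> 81 ^ card F * card Y" by fact
    also have "\<dots> \<le> 81 ^ card F * (81 * card Z)" using Z(2) by simp
    also have "\<dots> = 81 ^ card (insert \<theta> F) * card Z" using insert by simp
    finally have "card X \<le> \<dots>" .
    then show ?case using Y Z by (intro exI[of _ Z]) blast
  qed
  from this[OF fin order.refl]
  obtain Y where Y: "Y \<subseteq> X" "card X \<le> 81 ^ card \<Lambda> * card Y"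
    "\<And>\<theta> x y. \<theta> \<in> \<Lambda> \<Longrightarrow> x \<in> Y \<Longrightarrow> y \<in> Y \<Longrightarrow> cmod (cis (\<theta> * x) - cis (\<theta> * y)) \<le> \<rho>"
    by blast
  have finY: "finite Y" using Y(1) unfolding X_def by (rule finite_subset) simp
  have "cmod (complex_of_real (real_of_int x) - 0) \<le> 2 * (\<rho> * N)" if "x \<in> Y" for x
    using that Y(1) by (auto simp: X_def bohr_def)
  from pigeonhole_small_cell[of Y "\<rho> * N" "\<lambda>x. complex_of_real (real_of_int x)" 0, OF finY _ this]
  obtain Z where Z: "Z \<subseteq> Y" "card Y \<le> 81 * card Z"
    "\<And>x y. x \<in> Z \<Longrightarrow> y \<in> Z \<Longrightarrow> cmod (complex_of_real (real_of_int x) - complex_of_real (real_of_int y)) \<le> \<rho> * N"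
    using \<rho> N by auto
  have "card Z \<le> card (bohr N \<Lambda> \<rho>)"
  proof (cases "Z = {}")
    case False
    then obtain z where z: "z \<in> Z" by blast
    have "(\<lambda>x. x - z) ` Z \<subseteq> bohr N \<Lambda> \<rho>"
    proof
      fix w assume "w \<in> (\<lambda>x. x - z) ` Z"
      then obtain x where x: "x \<in> Z" "w = x - z" by blast
      have "\<bar>real_of_int x - real_of_int z\<bar> \<le> \<rho> * N"
        using Z(3)[OF x(1) z] by (metis of_real_diff norm_of_real)
      moreover have "cmod (cis (\<theta> * w) - 1) \<le> \<rho>" if "\<theta> \<in> \<Lambda>" for \<theta>
        using Y(3)[OF that, of x z] x z Z(1)
        by (auto simp: cmod_cis_diff right_diff_distrib)
      ultimately show "w \<in> bohr N \<Lambda> \<rho>" using x by (auto simp: bohr_def)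
    qed
    then have "card ((\<lambda>x. x - z) ` Z) \<le> card (bohr N \<Lambda> \<rho>)" by (intro card_mono) auto
    then show ?thesis by (subst (asm) card_image) (auto simp: inj_on_def)
  qed simp
  then have "card X \<le> 81 ^ card \<Lambda> * (81 * card (bohr N \<Lambda> \<rho>))"
    using Y(2) Z(2) by (meson le_trans mult_le_mono2)
  then show ?thesis by (simp add: X_def mult_ac)
qed

text \<open>
  Radius 2 imposes nothing on the characters, so that Bohr set is the full interval; each halving
  of the radius costs one doubling constant.
\<close>

lemma card_bohr_lower:
  assumes fin: "finite \<Lambda>" and N: "N \<ge> 1"
  shows "N \<le> 81 ^ ((card \<Lambda> + 1) * k) * real (card (bohr N \<Lambda> (2 / 2 ^ k)))"
proof (induction k)
  case 0
  have "{0..\<lfloor>N\<rfloor>} \<subseteq> bohr N \<Lambda> 2"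
  proof
    fix x assume x: "x \<in> {0..\<lfloor>N\<rfloor>}"
    have "real_of_int x \<le> N" using x by (simp add: le_floor_iff)
    moreover have "cmod (cis (\<theta> * x) - 1) \<le> 2" for \<theta> :: real
      using norm_triangle_ineq4[of "cis (\<theta> * x)" 1] by simp
    ultimately show "x \<in> bohr N \<Lambda> 2" using x N by (auto simp: bohr_def)
  qed
  then have "card {0..\<lfloor>N\<rfloor>} \<le> card (bohr N \<Lambda> 2)" by (intro card_mono) auto
  moreover have "N \<le> real (card {0..\<lfloor>N\<rfloor>})" using N by simp
  ultimately show ?case by simp
next
  case (Suc k)
  have "real (card (bohr N \<Lambda> (2 * (2 / 2 ^ Suc k))))
      \<le> real (81 ^ (card \<Lambda> + 1) * card (bohr N \<Lambda> (2 / 2 ^ Suc k)))"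
    using bohr_doubling[OF fin, of "2 / 2 ^ Suc k" N] N
    by (subst of_nat_le_iff) simp
  then have "real (card (bohr N \<Lambda> (2 / 2 ^ k)))
      \<le> 81 ^ (card \<Lambda> + 1) * real (card (bohr N \<Lambda> (2 / 2 ^ Suc k)))" by simp
  then have "81 ^ ((card \<Lambda> + 1) * k) * real (card (bohr N \<Lambda> (2 / 2 ^ k)))
      \<le> 81 ^ ((card \<Lambda> + 1) * k) * (81 ^ (card \<Lambda> + 1) * real (card (bohr N \<Lambda> (2 / 2 ^ Suc k))))"
    by (intro mult_left_mono) auto
  also have "\<dots> = 81 ^ ((card \<Lambda> + 1) * Suc k) * real (card (bohr N \<Lambda> (2 / 2 ^ Suc k)))"
    by (simp add: power_add mult_ac)
  finally show ?case using Suc by linarith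
qed

text \<open>
  Regularity at relative scale \<open>\<kappa>\<close>: shifting the Bohr set by an element of the one of radius \<open>\<kappa> \<rho>\<close>
  changes it by only an \<open>\<epsilon>\<close>-proportion, so such shifts can be treated as symmetries of the set.
\<close>

definition regular :: "real \<Rightarrow> real set \<Rightarrow> real \<Rightarrow> real \<Rightarrow> real \<Rightarrow> bool" where
  "regular N \<Lambda> \<epsilon> \<kappa> \<rho> \<longleftrightarrow>
     real (card (bohr N \<Lambda> ((1 + \<kappa>) * \<rho>))) \<le> (1 + \<epsilon>) * real (card (bohr N \<Lambda> ((1 - \<kappa>) * \<rho>)))"

text \<open>
  Cut \<open>[\<rho> / 2, \<rho>]\<close> into \<open>t\<close> equal pieces of length \<open>2 \<kappa> \<rho>\<close>. If the midpoint of each of them failed to be regular,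
  the size would grow by \<open>(1 + \<epsilon>)^t\<close> over the interval, beyond the doubling constant.
\<close>

lemma ex_regular:
  assumes fin: "finite \<Lambda>" and N: "N > 0" and \<epsilon>: "\<epsilon> > 0" and t: "t > 0"
    and big: "(1 + \<epsilon>) ^ t > 81 ^ (card \<Lambda> + 1)" and \<rho>: "\<rho> > 0"
  obtains \<rho>' where "\<rho> / 2 \<le> \<rho>'" "\<rho>' \<le> \<rho>" "regular N \<Lambda> \<epsilon> (1 / (4 * real t)) \<rho>'"
proof (rule ccontr)
  assume "\<not> thesis"
  with that have irr: "\<not> regular N \<Lambda> \<epsilon> (1 / (4 * real t)) \<rho>'" if "\<rho> / 2 \<le> \<rho>'" "\<rho>' \<le> \<rho>" for \<rho>'
    using \<open>\<And>\<rho>'. \<rho> / 2 \<le> \<rho>' \<Longrightarrow> \<rho>' \<le> \<rho> \<Longrightarrow> regular N \<Lambda> \<epsilon> (1 / (4 * real t)) \<rho>' \<Longrightarrow> thesis\<close> that by blast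
  define \<kappa> where "\<kappa> = 1 / (4 * real t)"
  define r where "r i = \<rho> / 2 + 2 * \<kappa> * \<rho> * real i" for i :: nat
  have \<kappa>: "\<kappa> > 0" "4 * \<kappa> * real t = 1" using t by (auto simp: \<kappa>_def)
  have grow: "(1 + \<epsilon>) ^ i * real (card (bohr N \<Lambda> (r 0))) \<le> real (card (bohr N \<Lambda> (r i)))"
    if "i \<le> t" for i
    using that
  proof (induction i)
    case (Suc i)
    define \<sigma> where "\<sigma> = r i + \<kappa> * \<rho>"
    have i: "real i + 1 \<le> real t" using Suc.prems by linarith
    have "2 * \<kappa> * \<rho> * (real i + 1) \<le> 2 * \<kappa> * \<rho> * real t"
      using i \<kappa> \<rho> by (intro mult_left_mono) auto
    also have "\<dots> = (4 * \<kappa> * real t) * (\<rho> / 2)" by simp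
    also have "\<dots> = \<rho> / 2" by (simp only: \<kappa>(2))
    finally have *: "2 * \<kappa> * \<rho> * real i + 2 * \<kappa> * \<rho> \<le> \<rho> / 2" by (simp add: distrib_left)
    have \<kappa>\<rho>: "\<kappa> * \<rho> > 0" using \<kappa> \<rho> by simp
    have r0: "2 * \<kappa> * \<rho> * real i \<ge> 0" using \<kappa> \<rho> by simp
    have \<sigma>: "\<rho> / 2 \<le> \<sigma>" "\<sigma> \<le> \<rho>" using * \<kappa>\<rho> r0 unfolding \<sigma>_def r_def by linarith+
    have le: "\<kappa> * \<sigma> \<le> \<kappa> * \<rho>" using \<sigma> \<kappa> by simp
    have "r (Suc i) = r i + 2 * (\<kappa> * \<rho>)" by (simp add: r_def algebra_simps)
    moreover have "(1 - \<kappa>) * \<sigma> = \<sigma> - \<kappa> * \<sigma>" "(1 + \<kappa>) * \<sigma> = \<sigma> + \<kappa> * \<sigma>"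
      by (simp_all add: algebra_simps)
    ultimately have eq1: "r i \<le> (1 - \<kappa>) * \<sigma>" and eq2: "(1 + \<kappa>) * \<sigma> \<le> r (Suc i)"
      using le by (simp_all add: \<sigma>_def)
    have "(1 + \<epsilon>) ^ Suc i * real (card (bohr N \<Lambda> (r 0))) \<le> (1 + \<epsilon>) * real (card (bohr N \<Lambda> (r i)))"
      using Suc \<epsilon> by (simp add: mult.assoc)
    also have "\<dots> \<le> (1 + \<epsilon>) * real (card (bohr N \<Lambda> ((1 - \<kappa>) * \<sigma>)))"
      using eq1 \<epsilon> N by (intro mult_left_mono of_nat_mono card_bohr_mono) auto
    also have "\<dots> \<le> real (card (bohr N \<Lambda> ((1 + \<kappa>) * \<sigma>)))"
      using irr[OF \<sigma>] by (simp add: regular_def \<kappa>_def)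
    also have "\<dots> \<le> real (card (bohr N \<Lambda> (r (Suc i))))"
      using eq2 N by (intro of_nat_mono card_bohr_mono) auto
    finally show ?case .
  qed simp
  have "r t = \<rho> / 2 + (4 * \<kappa> * real t) * (\<rho> / 2)" by (simp add: r_def)
  then have rt: "r t = 2 * (\<rho> / 2)" by (simp only: \<kappa>(2))
  have r0: "r 0 = \<rho> / 2" by (simp add: r_def)
  have pos: "real (card (bohr N \<Lambda> (\<rho> / 2))) > 0" using card_bohr_pos[of "\<rho> / 2" N] \<rho> N by simp
  have "real (card (bohr N \<Lambda> (2 * (\<rho> / 2)))) \<le> real (81 ^ (card \<Lambda> + 1) * card (bohr N \<Lambda> (\<rho> / 2)))"
    using bohr_doubling[OF fin, of "\<rho> / 2" N] \<rho> N by (subst of_nat_le_iff) simp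
  also have "\<dots> = 81 ^ (card \<Lambda> + 1) * real (card (bohr N \<Lambda> (\<rho> / 2)))" by simp
  also have "\<dots> < (1 + \<epsilon>) ^ t * real (card (bohr N \<Lambda> (\<rho> / 2)))"
    using big pos by (intro mult_strict_right_mono)
  also have "\<dots> \<le> real (card (bohr N \<Lambda> (2 * (\<rho> / 2))))"
    using grow[of t] unfolding rt r0 by simp
  finally show False by simp
qed

lemma regular_inner:
  assumes "regular N \<Lambda> \<epsilon> \<kappa> \<rho>" "N \<ge> 0" "\<rho> \<ge> 0" "\<kappa> \<ge> 0" "\<epsilon> \<ge> 0"
  shows "(1 - \<epsilon>) * real (card (bohr N \<Lambda> \<rho>)) \<le> real (card (bohr N \<Lambda> ((1 - \<kappa>) * \<rho>)))"
proof -
  let ?i = "real (card (bohr N \<Lambda> ((1 - \<kappa>) * \<rho>)))" and ?b = "real (card (bohr N \<Lambda> \<rho>))"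
  have "\<kappa> * \<rho> \<ge> 0" using assms by simp
  then have "?b \<le> real (card (bohr N \<Lambda> ((1 + \<kappa>) * \<rho>)))" "?i \<le> ?b"
    using assms by (auto intro!: card_bohr_mono simp: algebra_simps)
  then have "?b \<le> ?i + \<epsilon> * ?i" "\<epsilon> * ?i \<le> \<epsilon> * ?b"
    using assms unfolding regular_def by (auto simp: algebra_simps intro!: mult_left_mono)
  then show ?thesis by (simp add: algebra_simps)
qed

text \<open>
  Translating a regular Bohr set by \<open>y\<close> multiplies the character sum by \<open>cis (\<gamma> y)\<close> but hardly changes
  the set; if the sum is large, \<open>cis (\<gamma> y)\<close> must be close to 1.
\<close>

lemma large_spectrum_nearly_trivial:
  fixes \<gamma> :: real
  assumes reg: "regular N \<Lambda> \<epsilon> \<kappa> \<rho>" and N: "N \<ge> 0" and \<rho>: "\<rho> \<ge> 0" and \<epsilon>: "\<epsilon> \<ge> 0"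
    and y: "y \<in> bohr N \<Lambda> (\<kappa> * \<rho>)" and \<kappa>: "\<kappa> \<ge> 0"
    and big: "cmod (\<Sum>b\<in>bohr N \<Lambda> \<rho>. cis (\<gamma> * real_of_int b)) > card (bohr N \<Lambda> \<rho>) / 2"
  shows "cmod (cis (\<gamma> * y) - 1) \<le> 2 * \<epsilon>"
proof -
  let ?B = "bohr N \<Lambda> \<rho>" and ?I = "bohr N \<Lambda> ((1 - \<kappa>) * \<rho>)" and ?O = "bohr N \<Lambda> ((1 + \<kappa>) * \<rho>)"
  let ?S = "\<Sum>b\<in>?B. cis (\<gamma> * real_of_int b)"
  let ?T = "(\<lambda>b. b + y) ` ?B"
  have \<kappa>\<rho>: "\<kappa> * \<rho> \<ge> 0" using \<kappa> \<rho> by simp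
  have BO: "?B \<subseteq> ?O" "?I \<subseteq> ?B"
    using \<kappa>\<rho> N by (intro bohr_mono; simp add: algebra_simps)+
  have TO: "?T \<subseteq> ?O"
    using bohr_add[OF _ y] by (auto simp: algebra_simps)
  have IT: "?I \<subseteq> ?T"
  proof
    fix x assume "x \<in> ?I"
    then have "x - y \<in> bohr N \<Lambda> ((1 - \<kappa>) * \<rho> + \<kappa> * \<rho>)" using bohr_diff y by blast
    then have "x - y \<in> ?B" by (simp add: algebra_simps)
    then show "x \<in> ?T" by force
  qed
  have "cis (\<gamma> * y) * ?S = (\<Sum>b\<in>?B. cis (\<gamma> * real_of_int (b + y)))"
    by (simp add: sum_distrib_left cis_mult distrib_left add.commute)
  also have "\<dots> = (\<Sum>b\<in>?T. cis (\<gamma> * real_of_int b))"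
    by (subst sum.reindex) (auto simp: inj_on_def)
  finally have "(cis (\<gamma> * y) - 1) * ?S = (\<Sum>b\<in>?T. cis (\<gamma> * real_of_int b)) - ?S" by (simp add: algebra_simps)
  also have "\<dots> = (\<Sum>b\<in>?T - ?B. cis (\<gamma> * real_of_int b)) - (\<Sum>b\<in>?B - ?T. cis (\<gamma> * real_of_int b))"
    by (subst sum.Int_Diff[of ?T _ ?B], simp, subst sum.Int_Diff[of ?B _ ?T], simp)
       (simp add: Int_commute)
  finally have "cmod (cis (\<gamma> * y) - 1) * cmod ?S
      = cmod ((\<Sum>b\<in>?T - ?B. cis (\<gamma> * real_of_int b)) - (\<Sum>b\<in>?B - ?T. cis (\<gamma> * real_of_int b)))" 
    by (metis norm_mult)
  also have "\<dots> \<le> cmod (\<Sum>b\<in>?T - ?B. cis (\<gamma> * real_of_int b)) + cmod (\<Sum>b\<in>?B - ?T. cis (\<gamma> * real_of_int b))"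
    by (rule norm_triangle_ineq4)
  also have "\<dots> \<le> real (card (?T - ?B)) + real (card (?B - ?T))"
    by (intro add_mono order.trans[OF norm_sum]) auto
  also have "\<dots> = real (card ((?T - ?B) \<union> (?B - ?T)))"
    by (subst card_Un_disjoint) auto
  also have "\<dots> \<le> real (card (?O - ?I))"
    using BO TO IT by (intro of_nat_mono card_mono) auto
  also have "\<dots> = real (card ?O) - real (card ?I)"
    using BO by (subst card_Diff_subset) (auto intro!: of_nat_diff card_mono)
  also have "\<dots> \<le> \<epsilon> * real (card ?I)" using reg by (simp add: regular_def algebra_simps)
  also have "\<dots> \<le> \<epsilon> * real (card ?B)" using \<epsilon> BO by (intro mult_left_mono of_nat_mono card_mono) auto
  also have "\<dots> \<le> \<epsilon> * (2 * cmod ?S)" using big \<epsilon> by (intro mult_left_mono) auto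
  finally have "cmod (cis (\<gamma> * y) - 1) * cmod ?S \<le> (2 * \<epsilon>) * cmod ?S" by simp
  moreover have "cmod ?S > 0" using big by (smt (verit) divide_nonneg_nonneg of_nat_0_le_iff)
  ultimately show ?thesis by (simp only: mult_le_cancel_right_pos)
qed


section \<open>Fourier analysis with roots of unity\<close>

text \<open>
  The dual group is discretised: as long as \<open>M\<close> exceeds all differences that occur, the \<open>M\<close>-th roots of
  unity see the integers involved without any wrap-around.
\<close>

definition root_angle :: "nat \<Rightarrow> nat \<Rightarrow> real" where
  "root_angle M j = 2 * pi * real j / real M"

lemma sum_roots_of_unity:
  assumes M: "M > 0" and s: "\<bar>s\<bar> < int M"
  shows "(\<Sum>j<M. cis (root_angle M j * s)) = (if s = 0 then of_nat M else 0)"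
proof (cases "s = 0")
  case False
  define z where "z = cis (2 * pi * s / M)"
  have pow: "cis (root_angle M j * s) = z ^ j" for j
    unfolding z_def root_angle_def Complex.DeMoivre by (rule arg_cong[of _ _ cis]) simp
  have zM: "z ^ M = 1"
    unfolding z_def Complex.DeMoivre using M by simp
  have "z \<noteq> 1"
  proof
    assume "z = 1"
    then have "cos (2 * pi * s / M) = 1" by (simp add: z_def complex_eq_iff)
    then obtain k :: int where "2 * pi * s / M = real_of_int k * 2 * pi"
      by (subst (asm) cos_one_2pi_int) blast
    then have "real_of_int s = real_of_int (k * int M)" using M by (simp add: field_simps)
    then have sk: "s = k * int M" by (simp only: of_int_eq_iff)
    then have "k \<noteq> 0" using False by auto
    then have "1 * int M \<le> \<bar>k\<bar> * int M" by (intro mult_right_mono) auto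
    then show False using s sk by (simp add: abs_mult)
  qed
  then have "(\<Sum>j<M. z ^ j) = 0" by (simp add: geometric_sum zM)
  then show ?thesis using False by (simp add: pow)
qed (simp add: root_angle_def)

lemma parseval_ints:
  fixes c :: "int \<Rightarrow> complex"
  assumes M: "M > 0" and X: "finite X" and sep: "\<And>x y. x \<in> X \<Longrightarrow> y \<in> X \<Longrightarrow> \<bar>x - y\<bar> < int M"
  shows "(\<Sum>j<M. (cmod (\<Sum>x\<in>X. c x * cis (root_angle M j * x)))\<^sup>2) = M * (\<Sum>x\<in>X. (cmod (c x))\<^sup>2)"
proof -
  let ?t = "root_angle M"
  have "complex_of_real (\<Sum>j<M. (cmod (\<Sum>x\<in>X. c x * cis (?t j * x)))\<^sup>2)
      = (\<Sum>j<M. (\<Sum>x\<in>X. c x * cis (?t j * x)) * cnj (\<Sum>x\<in>X. c x * cis (?t j * x)))"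
    by (simp only: of_real_sum complex_norm_square)
  also have "\<dots> = (\<Sum>j<M. \<Sum>x\<in>X. \<Sum>y\<in>X. c x * cnj (c y) * cis (?t j * (x - y)))"
    by (simp add: sum_product cis_cnj cis_mult algebra_simps)
  also have "\<dots> = (\<Sum>x\<in>X. \<Sum>y\<in>X. \<Sum>j<M. c x * cnj (c y) * cis (?t j * (x - y)))"
    by (subst sum.swap, subst sum.swap[of _ _ "{..<M}"]) simp
  also have "\<dots> = (\<Sum>x\<in>X. \<Sum>y\<in>X. c x * cnj (c y) * (\<Sum>j<M. cis (?t j * real_of_int (x - y))))"
    by (simp add: sum_distrib_left)
  also have "\<dots> = (\<Sum>x\<in>X. \<Sum>y\<in>X. if x = y then c x * cnj (c y) * of_nat M else 0)"
    using M sep by (intro sum.cong refl) (subst sum_roots_of_unity, auto)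
  also have "\<dots> = (\<Sum>x\<in>X. c x * cnj (c x) * of_nat M)"
    using X by (simp add: sum.delta)
  also have "\<dots> = complex_of_real (M * (\<Sum>x\<in>X. (cmod (c x))\<^sup>2))"
    by (simp only: of_real_mult of_real_sum complex_norm_square of_real_of_nat_eq sum_distrib_left mult_ac)
  finally show ?thesis by (simp only: of_real_eq_iff)
qed

text \<open>
  The left-hand side counts the solutions of \<open>x + z = 2 y\<close>, with weight \<open>f x * f z\<close>; by orthogonality it
  is the sum over frequencies \<open>\<theta>\<close> of the square of the transform of \<open>f\<close> at \<open>\<theta>\<close> times the transform of \<open>Y\<close> at
  \<open>- 2 \<theta>\<close>.
\<close>

lemma weighted_midpoint_sum_fourier:
  fixes f :: "int \<Rightarrow> real"
  assumes M: "M > 0" and X: "finite X" and Y: "finite Y"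
    and sep: "\<And>x y z. x \<in> X \<Longrightarrow> z \<in> X \<Longrightarrow> y \<in> Y \<Longrightarrow> \<bar>x + z - 2 * y\<bar> < int M"
  shows "M * \<bar>\<Sum>y\<in>Y. \<Sum>x\<in>X. if 2 * y - x \<in> X then f x * f (2 * y - x) else 0\<bar>
     \<le> (\<Sum>j<M. (cmod (\<Sum>x\<in>X. of_real (f x) * cis (root_angle M j * x)))\<^sup>2
              * cmod (\<Sum>y\<in>Y. cis (2 * root_angle M j * y)))"
proof -
  let ?t = "root_angle M"
  define S where "S = (\<Sum>y\<in>Y. \<Sum>x\<in>X. if 2 * y - x \<in> X then f x * f (2 * y - x) else 0)"
  let ?F = "\<lambda>j. \<Sum>x\<in>X. complex_of_real (f x) * cis (?t j * x)"
  have S2: "S = (\<Sum>y\<in>Y. \<Sum>x\<in>X. \<Sum>z\<in>X. if x + z - 2 * y = 0 then f x * f z else 0)"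
    unfolding S_def
  proof (intro sum.cong refl)
    fix y x
    have "(\<Sum>z\<in>X. if x + z - 2 * y = 0 then f x * f z else 0) = (\<Sum>z\<in>X. if z = 2 * y - x then f x * f z else 0)"
      by (intro sum.cong refl) auto
    then show "(if 2 * y - x \<in> X then f x * f (2 * y - x) else 0)
        = (\<Sum>z\<in>X. if x + z - 2 * y = 0 then f x * f z else 0)"
      using X by (simp add: sum.delta)
  qed
  have "(\<Sum>j<M. ?F j * ?F j * (\<Sum>y\<in>Y. cis (- (2 * ?t j * y))))
      = (\<Sum>j<M. \<Sum>y\<in>Y. \<Sum>x\<in>X. \<Sum>z\<in>X. of_real (f x * f z) * cis (?t j * real_of_int (x + z - 2 * y)))"
  proof (intro sum.cong refl)
    fix j
    have "?F j * ?F j * (\<Sum>y\<in>Y. cis (- (2 * ?t j * y)))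
       = (\<Sum>y\<in>Y. cis (- (2 * ?t j * y)) * (\<Sum>x\<in>X. \<Sum>z\<in>X. complex_of_real (f x) * cis (?t j * x) * (complex_of_real (f z) * cis (?t j * z))))"
      by (simp add: sum_product[of _ X _ X] sum_distrib_right[symmetric] mult_ac)
    also have "\<dots> = (\<Sum>y\<in>Y. \<Sum>x\<in>X. \<Sum>z\<in>X. of_real (f x * f z) * (cis (?t j * x) * cis (?t j * z) * cis (- (2 * ?t j * y))))"
      by (simp add: sum_distrib_left mult_ac)
    also have "\<dots> = (\<Sum>y\<in>Y. \<Sum>x\<in>X. \<Sum>z\<in>X. of_real (f x * f z) * cis (?t j * real_of_int (x + z - 2 * y)))"
      by (simp add: cis_mult algebra_simps)
    finally show "?F j * ?F j * (\<Sum>y\<in>Y. cis (- (2 * ?t j * y))) = \<dots>" .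
  qed
  also have "\<dots> = (\<Sum>y\<in>Y. \<Sum>x\<in>X. \<Sum>z\<in>X. \<Sum>j<M. of_real (f x * f z) * cis (?t j * real_of_int (x + z - 2 * y)))"
    by (subst sum.swap, rule sum.cong[OF refl], subst sum.swap, rule sum.cong[OF refl], rule sum.swap)
  also have "\<dots> = (\<Sum>y\<in>Y. \<Sum>x\<in>X. \<Sum>z\<in>X. of_real (f x * f z) * (if x + z - 2 * y = 0 then of_nat M else 0))"
    using M sep by (intro sum.cong refl) (subst sum_roots_of_unity[symmetric], auto simp: sum_distrib_left)
  also have "\<dots> = complex_of_real (M * S)"
    unfolding S2 by (simp add: sum_distrib_left if_distrib[of "\<lambda>x. _ * x"] if_distrib[of complex_of_real] mult_ac cong: if_cong)
  finally have "M * \<bar>S\<bar> = cmod (\<Sum>j<M. ?F j * ?F j * (\<Sum>y\<in>Y. cis (- (2 * ?t j * y))))"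
    by (simp add: abs_mult norm_mult)
  also have "\<dots> \<le> (\<Sum>j<M. cmod (?F j * ?F j * (\<Sum>y\<in>Y. cis (- (2 * ?t j * y)))))"
    by (rule norm_sum)
  also have "\<dots> = (\<Sum>j<M. (cmod (?F j))\<^sup>2 * cmod (\<Sum>y\<in>Y. cis (2 * ?t j * y)))"
  proof (intro sum.cong refl)
    fix j
    have "(\<Sum>y\<in>Y. cis (- (2 * ?t j * y))) = cnj (\<Sum>y\<in>Y. cis (2 * ?t j * y))"
      by (simp add: cis_cnj)
    then show "cmod (?F j * ?F j * (\<Sum>y\<in>Y. cis (- (2 * ?t j * y))))
      = (cmod (?F j))\<^sup>2 * cmod (\<Sum>y\<in>Y. cis (2 * ?t j * y))"
      by (simp only: norm_mult complex_mod_cnj power2_eq_square)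
  qed
  finally show ?thesis by (simp add: S_def)
qed


section \<open>Moments of a random character on a Bohr set\<close>

lemma sum_PiE_lessThan_Suc:
  fixes h :: "(nat \<Rightarrow> 'a) \<Rightarrow> real"
  shows "(\<Sum>G\<in>PiE {..<Suc n} (\<lambda>_. J). h G) = (\<Sum>G\<in>PiE {..<n} (\<lambda>_. J). \<Sum>y\<in>J. h (G(n := y)))"
proof -
  have "(\<Sum>G\<in>PiE {..<Suc n} (\<lambda>_. J). h G)
      = (\<Sum>x\<in>J \<times> PiE {..<n} (\<lambda>_. J). h (case x of (y, g) \<Rightarrow> g(n := y)))"
    unfolding lessThan_Suc PiE_insert_eq
    by (subst sum.reindex[OF inj_combinator]) (auto intro!: sum.cong)
  also have "\<dots> = (\<Sum>y\<in>J. \<Sum>G\<in>PiE {..<n} (\<lambda>_. J). h (G(n := y)))"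
    by (simp add: sum.cartesian_product split_def)
  also have "\<dots> = (\<Sum>G\<in>PiE {..<n} (\<lambda>_. J). \<Sum>y\<in>J. h (G(n := y)))" by (rule sum.swap)
  finally show ?thesis .
qed

text \<open>
  Sample \<open>G 0, G 1, \<dots>\<close> independently with distribution \<open>p\<close>. Whatever the earlier samples are, the next
  one is bad with probability at most \<open>c\<close>, so it contributes a factor of at most \<open>1 + c\<close> to the
  expectation of \<open>2\<close> to the number of bad samples.
\<close>

lemma expected_power_of_bad_count:
  fixes p :: "'a \<Rightarrow> real" and bad :: "nat \<Rightarrow> (nat \<Rightarrow> 'a) \<Rightarrow> 'a \<Rightarrow> bool"
  assumes J: "finite J" and p: "\<And>j. j \<in> J \<Longrightarrow> p j \<ge> 0" and p1: "(\<Sum>j\<in>J. p j) = 1" and c: "c \<ge> 0"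
    and dep: "\<And>l G G' j. (\<And>i. i < l \<Longrightarrow> G i = G' i) \<Longrightarrow> bad l G j = bad l G' j"
    and small: "\<And>l G. l < n \<Longrightarrow> (\<And>i. i < l \<Longrightarrow> G i \<in> J) \<Longrightarrow> (\<Sum>j\<in>{j\<in>J. bad l G j}. p j) \<le> c"
  shows "(\<Sum>G\<in>PiE {..<n} (\<lambda>_. J). (\<Prod>l<n. p (G l)) * (\<Prod>l<n. if bad l G (G l) then 2 else 1)) \<le> (1 + c) ^ n"
  using small
proof (induction n)
  case (Suc n)
  define w where "w n G = (\<Prod>l<n. p (G l)) * (\<Prod>l<n. if bad l G (G l) then 2 else 1)" for n G
  have step: "(\<Sum>y\<in>J. w (Suc n) (G(n := y))) \<le> w n G * (1 + c)" if G: "G \<in> PiE {..<n} (\<lambda>_. J)" for G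
  proof -
    have GJ: "G i \<in> J" if "i < n" for i using G that by (auto simp: PiE_iff)
    have w0: "w n G \<ge> 0" unfolding w_def using GJ p by (intro mult_nonneg_nonneg prod_nonneg) auto
    have bad_upd: "bad l (G(n := y)) j = bad l G j" if "l \<le> n" for l y j
      using that by (intro dep) auto
    have "w (Suc n) (G(n := y)) = w n G * (p y * (if bad n G y then 2 else 1))" for y
    proof -
      have "(\<Prod>l<n. p ((G(n := y)) l)) = (\<Prod>l<n. p (G l))"
        by (intro prod.cong) auto
      moreover have "(\<Prod>l<n. if bad l (G(n := y)) ((G(n := y)) l) then 2 else (1::real))
          = (\<Prod>l<n. if bad l G (G l) then 2 else 1)"
        by (intro prod.cong) (auto simp: bad_upd)
      ultimately show ?thesis
        unfolding w_def prod.lessThan_Suc by (simp add: bad_upd)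
    qed
    then have "(\<Sum>y\<in>J. w (Suc n) (G(n := y))) = w n G * (\<Sum>y\<in>J. p y * (if bad n G y then 2 else 1))"
      by (simp add: sum_distrib_left)
    also have "(\<Sum>y\<in>J. p y * (if bad n G y then 2 else 1)) = (\<Sum>y\<in>J. p y + (if bad n G y then p y else 0))"
      by (intro sum.cong) auto
    also have "\<dots> = 1 + (\<Sum>y\<in>{j\<in>J. bad n G j}. p y)"
      using J by (simp add: sum.distrib p1 sum.If_cases Int_def)
    also have "w n G * \<dots> \<le> w n G * (1 + c)"
      using w0 Suc.prems[of n G] GJ by (intro mult_left_mono) auto
    finally show ?thesis .
  qed
  have "(\<Sum>G\<in>PiE {..<Suc n} (\<lambda>_. J). w (Suc n) G) \<le> (\<Sum>G\<in>PiE {..<n} (\<lambda>_. J). w n G * (1 + c))"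
    unfolding sum_PiE_lessThan_Suc by (intro sum_mono step)
  also have "\<dots> = (\<Sum>G\<in>PiE {..<n} (\<lambda>_. J). w n G) * (1 + c)" by (simp add: sum_distrib_right)
  also have "\<dots> \<le> (1 + c) ^ n * (1 + c)"
    using Suc.IH Suc.prems c unfolding w_def by (intro mult_right_mono) auto
  finally show ?case unfolding w_def by (simp add: mult.commute)
qed simp

lemma power_mean_even:
  fixes g :: "'a \<Rightarrow> real"
  assumes "finite A" "A \<noteq> {}" "even n"
  shows "((\<Sum>y\<in>A. g y) / card A) ^ n \<le> (\<Sum>y\<in>A. g y ^ n) / card A"
proof -
  have "(\<lambda>x. x ^ n) (\<Sum>y\<in>A. (1 / card A) *\<^sub>R g y) \<le> (\<Sum>y\<in>A. (1 / card A) * (\<lambda>x. x ^ n) (g y))"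
    using assms by (intro convex_on_sum[OF _ _ convex_power_even]) auto
  then show ?thesis by (simp add: sum_divide_distrib)
qed

definition bohr_ft :: "real \<Rightarrow> real set \<Rightarrow> real \<Rightarrow> real \<Rightarrow> complex" where
  "bohr_ft N \<Lambda> \<sigma> t = (\<Sum>b\<in>bohr N \<Lambda> \<sigma>. cis (t * real_of_int b)) / card (bohr N \<Lambda> \<sigma>)"

text \<open>
  Replacing a nonnegative trigonometric polynomial by its averages over translates of a small Bohr
  set multiplies each coefficient by \<open>bohr_ft\<close>. Its sum over a Bohr set does not decrease, once that
  set is enlarged by the small one.
\<close>

lemma bohr_smoothing_step:
  fixes c :: "'k \<Rightarrow> complex" and t :: "'k \<Rightarrow> real" and \<Lambda> :: "real set"
  assumes K: "finite K" and N: "N \<ge> 0" and \<sigma>: "\<sigma> \<ge> 0"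
    and nonneg: "\<And>y::int. Re (\<Sum>k\<in>K. c k * cis (t k * y)) \<ge> 0"
  defines "\<mu> \<equiv> bohr_ft N \<Lambda> \<sigma>"
  shows "Re (\<Sum>k\<in>K. c k * \<mu> (t k) * cis (t k * real_of_int y)) \<ge> 0" (is ?nn)
    and "Re (\<Sum>y\<in>bohr N \<Lambda> r. \<Sum>k\<in>K. c k * cis (t k * y))
          \<le> Re (\<Sum>y\<in>bohr N \<Lambda> (r + \<sigma>). \<Sum>k\<in>K. c k * \<mu> (t k) * cis (t k * y))" (is ?le)
proof -
  let ?B = "bohr N \<Lambda> \<sigma>"
  define H where "H y = (\<Sum>k\<in>K. c k * cis (t k * real_of_int y))" for y
  have pos: "card ?B > 0" using card_bohr_pos \<sigma> N by blast
  have avg: "(\<Sum>k\<in>K. c k * \<mu> (t k) * cis (t k * real_of_int y)) = (\<Sum>b\<in>?B. H (y + b)) / card ?B" for y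
  proof -
    have "(\<Sum>b\<in>?B. H (y + b)) = (\<Sum>k\<in>K. \<Sum>b\<in>?B. c k * cis (t k * y) * cis (t k * b))"
      unfolding H_def by (subst sum.swap) (simp add: distrib_left mult.assoc cis_mult)
    then show ?thesis
      unfolding \<mu>_def bohr_ft_def by (simp add: sum_divide_distrib sum_distrib_left sum_distrib_right mult_ac)
  qed
  have H0: "Re (H y) \<ge> 0" for y using nonneg by (simp add: H_def)
  have avgRe: "Re (\<Sum>k\<in>K. c k * \<mu> (t k) * cis (t k * real_of_int y)) = (\<Sum>b\<in>?B. Re (H (y + b))) / card ?B" for y
    unfolding avg by simp
  show ?nn unfolding avgRe using H0 by (intro divide_nonneg_nonneg sum_nonneg) auto
  have shift: "(\<Sum>y\<in>bohr N \<Lambda> r. Re (H y)) \<le> (\<Sum>y\<in>bohr N \<Lambda> (r + \<sigma>). Re (H (y + b)))" if "b \<in> ?B" for b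
  proof -
    have "(\<Sum>y\<in>bohr N \<Lambda> r. Re (H y)) = (\<Sum>y\<in>(\<lambda>y. y - b) ` bohr N \<Lambda> r. Re (H (y + b)))"
      by (subst sum.reindex) (auto simp: inj_on_def)
    also have "\<dots> \<le> (\<Sum>y\<in>bohr N \<Lambda> (r + \<sigma>). Re (H (y + b)))"
      using bohr_diff[OF _ that] H0 by (intro sum_mono2) auto
    finally show ?thesis .
  qed
  have "card ?B * (\<Sum>y\<in>bohr N \<Lambda> r. Re (H y)) = (\<Sum>b\<in>?B. \<Sum>y\<in>bohr N \<Lambda> r. Re (H y))" by simp
  also have "\<dots> \<le> (\<Sum>b\<in>?B. \<Sum>y\<in>bohr N \<Lambda> (r + \<sigma>). Re (H (y + b)))"
    by (intro sum_mono shift)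
  also have "\<dots> = (\<Sum>y\<in>bohr N \<Lambda> (r + \<sigma>). \<Sum>b\<in>?B. Re (H (y + b)))" by (rule sum.swap)
  finally have "(\<Sum>y\<in>bohr N \<Lambda> r. Re (H y)) \<le> (\<Sum>y\<in>bohr N \<Lambda> (r + \<sigma>). \<Sum>b\<in>?B. Re (H (y + b))) / card ?B"
    using pos by (simp add: field_simps)
  then show ?le unfolding Re_sum[of _ "bohr N \<Lambda> (r + \<sigma>)"] avgRe by (simp add: H_def sum_divide_distrib)
qed

text \<open>
  Iterating the smoothing \<open>L\<close> times makes every frequency whose \<open>bohr_ft\<close> is at most \<open>1 / 2\<close>
  contribute at most \<open>2^-L\<close>, at the price of enlarging the domain by \<open>L \<sigma>\<close>. This plays the part that
  exact orthogonality has on a group.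
\<close>

lemma bohr_smoothing:
  fixes c :: "'k \<Rightarrow> complex" and t :: "'k \<Rightarrow> real"
  assumes K: "finite K" and N: "N \<ge> 0" and \<sigma>: "\<sigma> \<ge> 0"
    and nonneg: "\<And>y::int. Re (\<Sum>k\<in>K. c k * cis (t k * y)) \<ge> 0"
  shows "Re (\<Sum>y\<in>bohr N \<Lambda> r. \<Sum>k\<in>K. c k * cis (t k * y))
          \<le> card (bohr N \<Lambda> (r + L * \<sigma>)) * (\<Sum>k\<in>K. cmod (c k) * cmod (bohr_ft N \<Lambda> \<sigma> (t k)) ^ L)"
  using nonneg
proof (induction L arbitrary: c r)
  case 0
  have "Re (\<Sum>y\<in>bohr N \<Lambda> r. \<Sum>k\<in>K. c k * cis (t k * y)) \<le> cmod (\<Sum>y\<in>bohr N \<Lambda> r. \<Sum>k\<in>K. c k * cis (t k * y))"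
    by (rule complex_Re_le_cmod)
  also have "\<dots> \<le> (\<Sum>y\<in>bohr N \<Lambda> r. \<Sum>k\<in>K. cmod (c k))"
    by (intro order.trans[OF norm_sum] sum_mono) (auto simp: norm_mult)
  finally show ?case by simp
next
  case (Suc L)
  have "Re (\<Sum>y\<in>bohr N \<Lambda> r. \<Sum>k\<in>K. c k * cis (t k * y))
      \<le> Re (\<Sum>y\<in>bohr N \<Lambda> (r + \<sigma>). \<Sum>k\<in>K. (c k * bohr_ft N \<Lambda> \<sigma> (t k)) * cis (t k * y))"
    by (rule bohr_smoothing_step(2)[OF K N \<sigma> Suc.prems])
  also have "\<dots> \<le> card (bohr N \<Lambda> (r + \<sigma> + L * \<sigma>))
       * (\<Sum>k\<in>K. cmod (c k * bohr_ft N \<Lambda> \<sigma> (t k)) * cmod (bohr_ft N \<Lambda> \<sigma> (t k)) ^ L)"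
    by (rule Suc.IH) (rule bohr_smoothing_step(1)[OF K N \<sigma> Suc.prems])
  also have "\<dots> = card (bohr N \<Lambda> (r + Suc L * \<sigma>)) * (\<Sum>k\<in>K. cmod (c k) * cmod (bohr_ft N \<Lambda> \<sigma> (t k)) ^ Suc L)"
    by (simp add: norm_mult mult_ac algebra_simps)
  finally show ?case .
qed

text \<open>
  Let \<open>F y\<close> be the expectation of \<open>\<omega> j * cis (\<psi> j y)\<close> when \<open>j\<close> has distribution \<open>p\<close>. Then \<open>\<bar>F\<bar>\<close> averages at least
  \<open>\<eta>\<close> over \<open>A\<close>, and by convexity its power \<open>2 m\<close> averages at least \<open>\<eta>^(2 m)\<close>. Expanding
  \<open>\<bar>F\<bar>^(2 m) = F^m * cnj F^m\<close> produces the signed sums of \<open>m + m\<close> independent frequencies.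
  The pattern \<open>s\<close> selects which \<open>2 m\<close> of the \<open>n\<close> samples take part, and with which sign;
  the others enter through the factor \<open>(\<Sum>j\<in>J. p j) = 1\<close>, so that all patterns are tested on one common
  sample \<open>G\<close>.
\<close>

lemma moment_expansion:
  fixes p \<psi> :: "'a \<Rightarrow> real" and \<omega> :: "'a \<Rightarrow> complex" and s :: "nat \<Rightarrow> real" and \<eta> :: real
  assumes J: "finite J" and p: "\<And>j. j \<in> J \<Longrightarrow> p j \<ge> 0" and p1: "(\<Sum>j\<in>J. p j) = 1"
    and \<omega>: "\<And>j. j \<in> J \<Longrightarrow> cmod (\<omega> j) \<le> 1"
    and N: "N \<ge> 0" and \<sigma>: "\<sigma> \<ge> 0" and A: "A \<subseteq> bohr N \<Lambda> r" "A \<noteq> {}"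
    and s: "\<And>l. l < n \<Longrightarrow> s l \<in> {-1, 0, 1}"
    and sU: "card {l\<in>{..<n}. s l = 1} = m" and sV: "card {l\<in>{..<n}. s l = -1} = m"
    and \<eta>: "\<eta> \<ge> 0" "\<eta> * card A \<le> cmod (\<Sum>y\<in>A. \<Sum>j\<in>J. of_real (p j) * \<omega> j * cis (\<psi> j * y))"
  shows "\<eta> ^ (2 * m) * card A \<le> card (bohr N \<Lambda> (r + L * \<sigma>)) *
     (\<Sum>G\<in>PiE {..<n} (\<lambda>_. J). (\<Prod>l<n. p (G l)) * cmod (bohr_ft N \<Lambda> \<sigma> (\<Sum>l<n. s l * \<psi> (G l))) ^ L)"
proof -
  define F where "F y = (\<Sum>j\<in>J. of_real (p j) * \<omega> j * cis (\<psi> j * real_of_int y))" for y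
  define u where "u l j = (if s l = 1 then \<omega> j else if s l = -1 then cnj (\<omega> j) else 1)" for l j
  define c where "c G = (\<Prod>l<n. of_real (p (G l)) * u l (G l))" for G
  define T where "T G = (\<Sum>l<n. s l * \<psi> (G l))" for G
  let ?K = "PiE {..<n} (\<lambda>_. J)"
  have finA: "finite A" using A(1) finite_subset finite_bohr by blast
  have cardA: "card A > 0" using finA A(2) by (simp add: card_gt_0_iff)
  have finK: "finite ?K" using J by (intro finite_PiE) auto
  have expand: "(\<Sum>G\<in>?K. c G * cis (T G * real_of_int y)) = of_real (cmod (F y) ^ (2 * m))" for y
  proof -
    have cprod: "c G * cis (T G * real_of_int y)
        = (\<Prod>l<n. of_real (p (G l)) * u l (G l) * cis (s l * \<psi> (G l) * real_of_int y))" for G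
    proof -
      have "cis (T G * real_of_int y) = (\<Prod>l<n. cis (s l * \<psi> (G l) * real_of_int y))"
        unfolding T_def sum_distrib_right by (induction n) (auto simp flip: cis_mult)
      then show ?thesis by (simp add: c_def prod.distrib)
    qed
    have factor: "(\<Sum>j\<in>J. of_real (p j) * u l j * cis (s l * \<psi> j * real_of_int y))
        = (if s l = 1 then F y else if s l = -1 then cnj (F y) else 1)" if "l < n" for l
    proof -
      have p1': "(\<Sum>j\<in>J. complex_of_real (p j)) = 1"
        using p1 by (metis of_real_1 of_real_sum)
      show ?thesis using s[OF that] p1' by (auto simp: u_def F_def cis_cnj)
    qed
    have "(\<Sum>G\<in>?K. c G * cis (T G * real_of_int y))
        = (\<Prod>l<n. \<Sum>j\<in>J. of_real (p j) * u l j * cis (s l * \<psi> j * real_of_int y))"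
      unfolding cprod using J by (subst prod_sum_PiE) auto
    also have "\<dots> = (\<Prod>l<n. (if s l = 1 then F y else 1) * (if s l = -1 then cnj (F y) else 1))"
      using factor by (intro prod.cong) auto
    also have "\<dots> = F y ^ m * cnj (F y) ^ m"
      unfolding prod.distrib using sU sV
      by (simp add: prod.If_cases Int_def)
    also have "\<dots> = of_real (cmod (F y) ^ (2 * m))"
      by (simp only: power_mult_distrib[symmetric] complex_norm_square[symmetric] power_mult of_real_power)
    finally show ?thesis .
  qed
  have cmod_c: "cmod (c G) \<le> (\<Prod>l<n. p (G l))" if "G \<in> ?K" for G
  proof -
    have GJ: "G l \<in> J" if "l < n" for l using \<open>G \<in> ?K\<close> that by (auto simp: PiE_iff)
    have "cmod (u l (G l)) \<le> 1" if "l < n" for l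
      using \<omega>[OF GJ[OF that]] by (auto simp: u_def)
    then have "cmod (of_real (p (G l)) * u l (G l)) \<le> p (G l)" if "l < n" for l
      using p[OF GJ[OF that]] that by (simp add: norm_mult mult_left_le)
    then show ?thesis unfolding c_def prod_norm[symmetric] by (intro prod_mono) auto
  qed
  have "\<eta> * card A \<le> (\<Sum>y\<in>A. cmod (F y))"
    using \<eta>(2) norm_sum[of F A] by (simp add: F_def)
  then have "\<eta> \<le> (\<Sum>y\<in>A. cmod (F y)) / card A" using cardA by (simp add: field_simps)
  then have "\<eta> ^ (2 * m) \<le> ((\<Sum>y\<in>A. cmod (F y)) / card A) ^ (2 * m)"
    using \<eta>(1) by (rule power_mono)
  also have "\<dots> \<le> (\<Sum>y\<in>A. cmod (F y) ^ (2 * m)) / card A"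
    using finA A(2) by (intro power_mean_even) auto
  finally have "\<eta> ^ (2 * m) * card A \<le> (\<Sum>y\<in>A. cmod (F y) ^ (2 * m))"
    using cardA by (simp add: field_simps)
  also have "\<dots> \<le> (\<Sum>y\<in>bohr N \<Lambda> r. cmod (F y) ^ (2 * m))"
    using A by (intro sum_mono2) auto
  also have "\<dots> = Re (\<Sum>y\<in>bohr N \<Lambda> r. \<Sum>G\<in>?K. c G * cis (T G * y))"
    unfolding expand by simp
  also have "\<dots> \<le> card (bohr N \<Lambda> (r + L * \<sigma>)) * (\<Sum>G\<in>?K. cmod (c G) * cmod (bohr_ft N \<Lambda> \<sigma> (T G)) ^ L)"
    by (rule bohr_smoothing[OF finK N \<sigma>]) (simp add: expand)
  also have "\<dots> \<le> card (bohr N \<Lambda> (r + L * \<sigma>)) * (\<Sum>G\<in>?K. (\<Prod>l<n. p (G l)) * cmod (bohr_ft N \<Lambda> \<sigma> (T G)) ^ L)"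
    by (intro mult_left_mono sum_mono mult_right_mono cmod_c) auto
  finally show ?thesis by (simp add: T_def)
qed


section \<open>Concentration of the spectrum near few frequencies\<close>

text \<open>
  The sign attached to a position depends on the position only. Hence the difference of two
  signed sums over sets of positions has all its coefficients in \<open>{-1, 0, 1}\<close>.
\<close>

definition halfsign :: "nat \<Rightarrow> nat \<Rightarrow> real" where
  "halfsign h l = (if l < h then 1 else -1)"

definition balanced_sets :: "nat \<Rightarrow> nat \<Rightarrow> nat set set" where
  "balanced_sets h m =
     {S. S \<subseteq> {..<2 * h} \<and> card (S \<inter> {..<h}) = m \<and> card (S \<inter> {h..<2 * h}) = m}"

lemma finite_balanced_sets [simp]: "finite (balanced_sets h m)"
  by (rule finite_subset[of _ "Pow {..<2 * h}"]) (auto simp: balanced_sets_def)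

lemma card_balanced_sets: "(h choose m) ^ 2 \<le> card (balanced_sets h m)"
proof -
  let ?P = "{U. U \<subseteq> {..<h} \<and> card U = m} \<times> {V. V \<subseteq> {h..<2 * h} \<and> card V = m}"
  have "inj_on (\<lambda>(U, V). U \<union> V) ?P"
  proof (rule inj_onI, clarify)
    fix U V U' V' :: "nat set"
    assume sub: "U \<subseteq> {..<h}" "V \<subseteq> {h..<2 * h}" "U' \<subseteq> {..<h}" "V' \<subseteq> {h..<2 * h}"
      and eq: "U \<union> V = U' \<union> V'"
    have "U = (U \<union> V) \<inter> {..<h}" "U' = (U' \<union> V') \<inter> {..<h}"
      "V = (U \<union> V) \<inter> {h..}" "V' = (U' \<union> V') \<inter> {h..}" using sub by auto
    then show "U = U' \<and> V = V'" using eq by metis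
  qed
  then have "card ?P = card ((\<lambda>(U, V). U \<union> V) ` ?P)" by (rule card_image[symmetric])
  also have "\<dots> \<le> card (balanced_sets h m)"
  proof (rule card_mono[OF finite_balanced_sets], rule subsetI)
    fix S assume "S \<in> (\<lambda>(U, V). U \<union> V) ` ?P"
    then obtain U V where UV: "S = U \<union> V" "U \<subseteq> {..<h}" "V \<subseteq> {h..<2 * h}" "card U = m" "card V = m"
      by auto
    have "S \<inter> {..<h} = U" "S \<inter> {h..<2 * h} = V" "S \<subseteq> {..<2 * h}" using UV by auto
    then show "S \<in> balanced_sets h m" using UV by (simp add: balanced_sets_def)
  qed
  finally show ?thesis
    by (simp add: card_cartesian_product n_subsets power2_eq_square)
qed

text \<open>
  Membership in the \<open>{-1, 0, 1}\<close>-span of \<open>\<theta> 0, \<dots>, \<theta> (l - 1)\<close>, up to a difference of two elements of the set \<open>P\<close>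
  of frequencies that count as negligible.
\<close>

definition almost_spanned :: "(real \<Rightarrow> bool) \<Rightarrow> nat \<Rightarrow> (nat \<Rightarrow> real) \<Rightarrow> real \<Rightarrow> bool" where
  "almost_spanned P l \<theta> t \<longleftrightarrow>
     (\<exists>e \<gamma> \<gamma>'. (\<forall>i<l. e i \<in> {-1, 0, 1}) \<and> P \<gamma> \<and> P \<gamma>' \<and> t = (\<Sum>i<l. e i * \<theta> i) + \<gamma> - \<gamma>')"

lemma almost_spannedI:
  assumes "\<And>i. i < l \<Longrightarrow> e i \<in> {-1, 0, 1}" "P \<gamma>" "P \<gamma>'" "t = (\<Sum>i<l. e i * \<theta> i) + \<gamma> - \<gamma>'"
  shows "almost_spanned P l \<theta> t"
  unfolding almost_spanned_def
  by (rule exI[of _ e], rule exI[of _ \<gamma>], rule exI[of _ \<gamma>']) (use assms in simp)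

text \<open>
  Subtract two different relations that agree on the bad positions. The last position where they
  differ is not bad, yet the difference expresses its frequency through earlier ones: a
  contradiction. So a relation is determined by its bad positions.
\<close>

lemma relations_inject_into_spanned_positions:
  fixes \<theta> :: "nat \<Rightarrow> real" and P :: "real \<Rightarrow> bool"
  defines "Bad \<equiv> {l. almost_spanned P l \<theta> (\<theta> l)}"
  shows "inj_on (\<lambda>S. S \<inter> Bad) {S. S \<subseteq> {..<n} \<and> P (\<Sum>l\<in>S. halfsign h l * \<theta> l)}"
proof (rule inj_onI, rule ccontr)
  fix S S' assume S: "S \<in> {S. S \<subseteq> {..<n} \<and> P (\<Sum>l\<in>S. halfsign h l * \<theta> l)}"
    and S': "S' \<in> {S. S \<subseteq> {..<n} \<and> P (\<Sum>l\<in>S. halfsign h l * \<theta> l)}"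
    and eq: "S \<inter> Bad = S' \<inter> Bad" and ne: "S \<noteq> S'"
  define D where "D = (S - S') \<union> (S' - S)"
  have D: "D \<noteq> {}" "D \<subseteq> {..<n}" "finite D" 
  proof -
    show "D \<noteq> {}" using ne by (auto simp: D_def)
    show "D \<subseteq> {..<n}" using S S' by (auto simp: D_def)
    then show "finite D" by (rule finite_subset) simp
  qed
  define l where "l = Max D"
  have lD: "l \<in> D" and lmax: "\<And>i. i \<in> D \<Longrightarrow> i \<le> l" using D by (auto simp: l_def)
  have "l \<notin> Bad" using lD eq by (auto simp: D_def)
  define d :: "nat \<Rightarrow> real" where "d i = halfsign h i * (of_bool (i \<in> S) - of_bool (i \<in> S'))" for i
  have d_val: "d i \<in> {-1, 0, 1}" for i by (auto simp: d_def halfsign_def)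
  have d_l: "d l \<in> {-1, 1}" using lD by (auto simp: d_def halfsign_def D_def)
  have d_0: "d i = 0" if "i > l" for i
    using lmax[of i] that by (auto simp: d_def D_def)
  let ?\<gamma> = "\<Sum>l\<in>S. halfsign h l * \<theta> l" and ?\<gamma>' = "\<Sum>l\<in>S'. halfsign h l * \<theta> l"
  have P\<gamma>: "P ?\<gamma>" "P ?\<gamma>'" using S S' by auto
  have restr: "(\<Sum>l\<in>R. halfsign h l * \<theta> l) = (\<Sum>i<n. halfsign h i * of_bool (i \<in> R) * \<theta> i)"
    if "R \<subseteq> {..<n}" for R
    using that by (intro sum.mono_neutral_cong_left) auto
  have "?\<gamma> - ?\<gamma>' = (\<Sum>i<n. d i * \<theta> i)"
  proof -
    have "S \<subseteq> {..<n}" "S' \<subseteq> {..<n}" using S S' by auto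
    then show ?thesis
      by (simp only: restr d_def sum_subtractf[symmetric]) (simp add: algebra_simps)
  qed
  also have "\<dots> = (\<Sum>i<Suc l. d i * \<theta> i)"
    using d_0 lD D(2) by (intro sum.mono_neutral_right) auto
  finally have rel: "d l * \<theta> l = ?\<gamma> - ?\<gamma>' - (\<Sum>i<l. d i * \<theta> i)" by simp
  have "almost_spanned P l \<theta> (\<theta> l)"
  proof (cases "d l = 1")
    case True
    then have eq1: "\<theta> l = (\<Sum>i<l. (- d i) * \<theta> i) + ?\<gamma> - ?\<gamma>'" using rel by (simp add: sum_negf)
    have "- d i \<in> {-1, 0, 1}" for i using d_val[of i] by auto
    then show ?thesis by (rule almost_spannedI[OF _ P\<gamma> eq1])
  next
    case False
    then have eq2: "\<theta> l = (\<Sum>i<l. d i * \<theta> i) + ?\<gamma>' - ?\<gamma>" using rel d_l by auto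
    show ?thesis by (rule almost_spannedI[OF d_val P\<gamma>(2,1) eq2])
  qed
  with \<open>l \<notin> Bad\<close> show False by (simp add: Bad_def)
qed

lemma exp_one_power_le: "exp (real m) \<le> 3 ^ m"
proof -
  have "exp (real m) = exp 1 ^ m" by (simp add: exp_of_nat_mult[symmetric])
  also have "\<dots> \<le> 3 ^ m" using exp_le by (intro power_mono) auto
  finally show ?thesis .
qed

text \<open>
  This is where the rank \<open>1 / \<eta>\<close>, and not \<open>1 / \<eta>\<^sup>2\<close>, comes from. Take \<open>n = 2 m k\<close> samples with \<open>k\<close> about \<open>8 / \<eta>\<close>.
  There are at least \<open>k^(2 m)\<close> balanced signed sums, and each is a relation with probability at least
  \<open>\<eta>^(2 m) / (2 K)\<close>, so about \<open>64^m / (2 K)\<close> relations are expected. If every span had mass at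
  most \<open>\<eta> / 18\<close>, the expected number of relations would be at most \<open>(1 + \<eta> / 18)^n \<le> exp m \<le> 3^m\<close>.
  Since \<open>2 K \<le> 2^m\<close>, these two estimates contradict each other.
\<close>

lemma concentrated_near_few_frequencies:
  fixes p \<psi> :: "'a \<Rightarrow> real" and \<omega> :: "'a \<Rightarrow> complex" and \<eta> K :: real
  assumes J: "finite J" and p: "\<And>j. j \<in> J \<Longrightarrow> p j \<ge> 0" and p1: "(\<Sum>j\<in>J. p j) = 1"
    and \<omega>: "\<And>j. j \<in> J \<Longrightarrow> cmod (\<omega> j) \<le> 1"
    and N: "N \<ge> 0" and \<sigma>: "\<sigma> \<ge> 0" and A: "A \<subseteq> bohr N \<Lambda> r" "A \<noteq> {}"
    and \<eta>: "0 < \<eta>" "\<eta> \<le> 1" "\<eta> * card A \<le> cmod (\<Sum>y\<in>A. \<Sum>j\<in>J. of_real (p j) * \<omega> j * cis (\<psi> j * y))"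
    and K: "K > 0" "card (bohr N \<Lambda> (r + L * \<sigma>)) \<le> K * card A"
    and m: "2 * K \<le> 2 ^ m" "m > 0" and L: "2 * K \<le> \<eta> ^ (2 * m) * 2 ^ L"
  obtains l \<theta> where "real l \<le> 18 * m / \<eta>"
    "(\<Sum>j\<in>{j\<in>J. almost_spanned (\<lambda>t. cmod (bohr_ft N \<Lambda> \<sigma> t) > 1/2) l \<theta> (\<psi> j)}. p j) > \<eta> / 18"
proof -
  define P where "P t \<longleftrightarrow> cmod (bohr_ft N \<Lambda> \<sigma> t) > 1/2" for t
  define k where "k = nat \<lceil>8 / \<eta>\<rceil>"
  have k: "8 / \<eta> \<le> k" "k \<le> 9 / \<eta>"
  proof -
    have "8 / \<eta> \<ge> 0" using \<eta> by simp
    then show "8 / \<eta> \<le> k" unfolding k_def by linarith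
    have "real k \<le> 8 / \<eta> + 1" unfolding k_def using \<open>8 / \<eta> \<ge> 0\<close> by linarith
    also have "\<dots> \<le> 9 / \<eta>" using \<eta> by (simp add: field_simps)
    finally show "k \<le> 9 / \<eta>" .
  qed
  have k0: "k > 0" using k(1) \<eta>(1) by (intro Nat.gr0I) auto
  define h where "h = m * k"
  define n where "n = 2 * h"
  have n_le: "real n \<le> 18 * m / \<eta>"
  proof -
    have "real n = 2 * m * real k" by (simp add: n_def h_def)
    also have "\<dots> \<le> 2 * m * (9 / \<eta>)" using k by (intro mult_left_mono) auto
    finally show ?thesis by simp
  qed
  let ?B = "balanced_sets h m" and ?K = "PiE {..<n} (\<lambda>_. J)"
  define w where "w G = (\<Prod>l<n. p (G l))" for G
  define T where "T S G = (\<Sum>l\<in>S. halfsign h l * \<psi> (G l))" for S G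
  have w0: "w G \<ge> 0" if "G \<in> ?K" for G
    using that p unfolding w_def by (intro prod_nonneg) (auto simp: PiE_iff)
  have w1: "(\<Sum>G\<in>?K. w G) = 1"
    unfolding w_def using J p1 by (subst prod_sum_PiE[symmetric]) auto
  \<comment> \<open>The moment bound for one signed sum; the frequencies outside the large spectrum contribute at most half of it.\<close>
  have many: "(\<Sum>G\<in>?K. w G * of_bool (P (T S G))) \<ge> \<eta> ^ (2 * m) / (2 * K)" if S: "S \<in> ?B" for S
  proof -
    define s where "s l = (if l \<in> S then halfsign h l else 0)" for l
    have Sn: "S \<subseteq> {..<n}" using S by (auto simp: balanced_sets_def n_def)
    have "{l\<in>{..<n}. s l = 1} = S \<inter> {..<h}" "{l\<in>{..<n}. s l = -1} = S \<inter> {h..<2 * h}"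
      using Sn by (auto simp: s_def halfsign_def n_def split: if_splits)
    then have cards: "card {l\<in>{..<n}. s l = 1} = m" "card {l\<in>{..<n}. s l = -1} = m"
      using S by (auto simp: balanced_sets_def)
    have sT: "(\<Sum>l<n. s l * \<psi> (G l)) = T S G" for G
      unfolding T_def s_def using Sn by (intro sum.mono_neutral_cong_right) auto
    have "\<eta> ^ (2 * m) * card A \<le> card (bohr N \<Lambda> (r + L * \<sigma>)) *
       (\<Sum>G\<in>?K. (\<Prod>l<n. p (G l)) * cmod (bohr_ft N \<Lambda> \<sigma> (\<Sum>l<n. s l * \<psi> (G l))) ^ L)"
      using \<eta> by (intro moment_expansion[OF J p p1 \<omega> N \<sigma> A _ cards])
        (auto simp: s_def halfsign_def)
    also have "\<dots> = card (bohr N \<Lambda> (r + L * \<sigma>)) * (\<Sum>G\<in>?K. w G * cmod (bohr_ft N \<Lambda> \<sigma> (T S G)) ^ L)"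
      by (simp add: sT w_def)
    also have "\<dots> \<le> K * card A * (\<Sum>G\<in>?K. w G * cmod (bohr_ft N \<Lambda> \<sigma> (T S G)) ^ L)"
      using K w0 by (intro mult_right_mono sum_nonneg mult_nonneg_nonneg) auto
    finally have "card A * (\<eta> ^ (2 * m)) \<le> card A * (K * (\<Sum>G\<in>?K. w G * cmod (bohr_ft N \<Lambda> \<sigma> (T S G)) ^ L))"
      by (simp add: mult_ac)
    moreover have "card A > 0" using A finite_subset[OF A(1)] by (simp add: card_gt_0_iff)
    ultimately have "\<eta> ^ (2 * m) \<le> K * (\<Sum>G\<in>?K. w G * cmod (bohr_ft N \<Lambda> \<sigma> (T S G)) ^ L)"
      by (simp only: mult_le_cancel_left_pos of_nat_0_less_iff)
    also have "\<dots> \<le> K * (\<Sum>G\<in>?K. w G * (of_bool (P (T S G)) + 1 / 2 ^ L))"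
    proof (intro mult_left_mono sum_mono)
      fix G assume "G \<in> ?K"
      let ?u = "cmod (bohr_ft N \<Lambda> \<sigma> (T S G))"
      have "?u \<le> 1"
        unfolding bohr_ft_def norm_divide using norm_sum[of "\<lambda>b. cis (T S G * real_of_int b)" "bohr N \<Lambda> \<sigma>"]
        by (auto simp: divide_le_eq_1)
      then have "?u ^ L \<le> 1" by (intro power_le_one) auto
      moreover have "?u ^ L \<le> (1/2) ^ L" if "\<not> P (T S G)"
        using that by (intro power_mono) (auto simp: P_def)
      ultimately show "?u ^ L \<le> of_bool (P (T S G)) + 1 / 2 ^ L"
        by (auto simp: power_one_over of_bool_def intro: add_increasing2)
    qed (use K w0 in auto)
    also have "\<dots> = K * (\<Sum>G\<in>?K. w G * of_bool (P (T S G))) + K / 2 ^ L"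
      by (simp add: distrib_left sum.distrib w1 sum_divide_distrib[symmetric] del: of_bool_eq_0_iff)
    also have "K / 2 ^ L \<le> \<eta> ^ (2 * m) / 2" using L by (simp add: field_simps)
    finally have "\<eta> ^ (2 * m) / 2 \<le> K * (\<Sum>G\<in>?K. w G * of_bool (P (T S G)))" by simp
    then show ?thesis using K by (simp add: field_simps)
  qed
  \<comment> \<open>Otherwise the expected number of relations is both large and small.\<close>
  have "\<exists>l<n. \<exists>G. (\<Sum>j\<in>{j\<in>J. almost_spanned P l (\<lambda>i. \<psi> (G i)) (\<psi> j)}. p j) > \<eta> / 18"
  proof (rule ccontr)
    assume "\<not> ?thesis"
    then have small: "(\<Sum>j\<in>{j\<in>J. almost_spanned P l (\<lambda>i. \<psi> (G i)) (\<psi> j)}. p j) \<le> \<eta> / 18"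
      if "l < n" for l and G :: "nat \<Rightarrow> 'a" using that by (meson not_le)
    define bad where "bad l G j = almost_spanned P l (\<lambda>i. \<psi> (G i)) (\<psi> j)" for l and G :: "nat \<Rightarrow> 'a" and j
    \<comment> \<open>For a fixed sample, relations inject into the sets of bad positions.\<close>
    have few: "real (card {S\<in>?B. P (T S G)}) \<le> (\<Prod>l<n. if bad l G (G l) then 2 else 1)" for G
    proof -
      let ?Bad = "{l. bad l G (G l)}"
      have sub: "{S\<in>?B. P (T S G)} \<subseteq> {S. S \<subseteq> {..<n} \<and> P (\<Sum>l\<in>S. halfsign h l * \<psi> (G l))}"
        by (auto simp: T_def balanced_sets_def n_def)
      have "inj_on (\<lambda>S. S \<inter> ?Bad) {S\<in>?B. P (T S G)}"
        unfolding bad_def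
        by (rule inj_on_subset[OF relations_inject_into_spanned_positions[of P "\<lambda>i. \<psi> (G i)" n h] sub])
      moreover have "(\<lambda>S. S \<inter> ?Bad) ` {S\<in>?B. P (T S G)} \<subseteq> Pow ({..<n} \<inter> ?Bad)"
        using sub by auto
      ultimately have "card {S\<in>?B. P (T S G)} \<le> card (Pow ({..<n} \<inter> ?Bad))"
        by (intro card_inj_on_le) auto
      then have "real (card {S\<in>?B. P (T S G)}) \<le> real (card (Pow ({..<n} \<inter> ?Bad)))"
        by (rule of_nat_mono)
      also have "\<dots> = (\<Prod>l<n. if bad l G (G l) then 2 else 1)"
        by (subst card_Pow) (auto simp: prod.If_cases)
      finally show ?thesis .
    qed
    have "real (card ?B) * (\<eta> ^ (2 * m) / (2 * K)) = (\<Sum>S\<in>?B. \<eta> ^ (2 * m) / (2 * K))" by simp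
    also have "\<dots> \<le> (\<Sum>S\<in>?B. \<Sum>G\<in>?K. w G * of_bool (P (T S G)))" by (intro sum_mono many)
    also have "\<dots> = (\<Sum>G\<in>?K. w G * real (card {S\<in>?B. P (T S G)}))"
      by (subst sum.swap) (simp add: sum_distrib_left[symmetric] sum.If_cases of_bool_def Int_def)
    also have "\<dots> \<le> (\<Sum>G\<in>?K. w G * (\<Prod>l<n. if bad l G (G l) then 2 else 1))"
      by (intro sum_mono mult_left_mono few w0)
    also have "\<dots> \<le> (1 + \<eta> / 18) ^ n"
      unfolding w_def
    proof (rule expected_power_of_bad_count[OF J p p1])
      show "bad l G j = bad l G' j" if "\<And>i. i < l \<Longrightarrow> G i = G' i" for l G G' j
        using that by (simp add: bad_def almost_spanned_def)
    qed (use \<eta> small in \<open>auto simp: bad_def\<close>)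
    also have "\<dots> \<le> exp (\<eta> / 18) ^ n"
      using \<eta> by (intro power_mono) auto
    also have "\<dots> = exp (real n * (\<eta> / 18))" by (rule exp_of_nat_mult[symmetric])
    also have "\<dots> \<le> exp (real m)"
      using n_le \<eta> by (simp add: field_simps)
    also have "\<dots> \<le> 3 ^ m" by (rule exp_one_power_le)
    finally have upper: "real (card ?B) * \<eta> ^ (2 * m) \<le> 2 * K * 3 ^ m" using K by (simp add: field_simps)
    have "real k ^ m \<le> real (h choose m)"
    proof -
      have "m \<le> h" using k0 by (simp add: h_def)
      from binomial_ge_n_over_k_pow_k[OF this, where 'a=real] show ?thesis
        using m by (simp add: h_def)
    qed
    then have "(real k ^ m)\<^sup>2 \<le> (real (h choose m))\<^sup>2" by (intro power_mono) auto
    also have "\<dots> \<le> real (card ?B)" using card_balanced_sets[of h m] by (metis of_nat_le_iff of_nat_power)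
    finally have "(real k ^ m)\<^sup>2 * \<eta> ^ (2 * m) \<le> real (card ?B) * \<eta> ^ (2 * m)"
      using \<eta> by (intro mult_right_mono) auto
    also note upper
    finally have "(real k ^ m)\<^sup>2 * \<eta> ^ (2 * m) \<le> 2 * K * 3 ^ m" .
    then have *: "(real k * \<eta>) ^ (2 * m) \<le> 2 * K * 3 ^ m"
      by (simp add: power_mult_distrib power_mult[symmetric] mult.commute[of m 2])
    have "8 \<le> real k * \<eta>" using k(1) \<eta> by (simp add: field_simps)
    then have "8 ^ (2 * m) \<le> (real k * \<eta>) ^ (2 * m)" by (intro power_mono) auto
    also note *
    also have "2 * K * 3 ^ m \<le> 2 ^ m * 3 ^ m" using m(1) by (intro mult_right_mono) auto
    also have "\<dots> = 6 ^ m" by (simp add: power_mult_distrib[symmetric])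
    finally have "64 ^ m \<le> (6::real) ^ m" by (simp add: power_mult)
    moreover have "(6::real) ^ m < 64 ^ m" using m by (intro power_strict_mono) auto
    ultimately show False by simp
  qed
  then obtain l G where "l < n" "(\<Sum>j\<in>{j\<in>J. almost_spanned P l (\<lambda>i. \<psi> (G i)) (\<psi> j)}. p j) > \<eta> / 18" by blast
  moreover have "real l \<le> 18 * m / \<eta>" using \<open>l < n\<close> n_le by linarith
  ultimately show thesis using that[of l "\<lambda>i. \<psi> (G i)"] unfolding P_def by simp
qed

lemma cmod_cis_sum: "finite I \<Longrightarrow> cmod (cis (\<Sum>i\<in>I. f i) - 1) \<le> (\<Sum>i\<in>I. cmod (cis (f i) - 1))"
proof (induction I rule: finite_induct)
  case (insert i I)
  then show ?case using cmod_cis_add[of "f i" "\<Sum>i\<in>I. f i"] by simp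
qed simp

lemma almost_spanned_close:
  assumes "almost_spanned P l \<theta> t"
    and P: "\<And>\<gamma>. P \<gamma> \<Longrightarrow> cmod (cis (\<gamma> * y) - 1) \<le> \<delta>"
    and \<theta>: "\<And>i. i < l \<Longrightarrow> cmod (cis (\<theta> i * y) - 1) \<le> \<tau>"
  shows "cmod (cis (t * y) - 1) \<le> l * \<tau> + 2 * \<delta>"
proof -
  obtain e \<gamma> \<gamma>' where e: "\<And>i. i < l \<Longrightarrow> e i \<in> {-1, 0, 1}" and \<gamma>: "P \<gamma>" "P \<gamma>'"
    and t: "t = (\<Sum>i<l. e i * \<theta> i) + \<gamma> - \<gamma>'"
    using assms(1) unfolding almost_spanned_def by (elim exE conjE) (rule that, auto)
  have ty: "t * y = (\<Sum>i<l. e i * \<theta> i * y) + (\<gamma> * y + - (\<gamma>' * y))"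
    unfolding t by (simp add: sum_distrib_right distrib_right left_diff_distrib)
  have "cmod (cis (e i * \<theta> i * y) - 1) \<le> \<tau>" if "i < l" for i
  proof -
    have "0 \<le> \<tau>" using \<theta>[OF that] norm_ge_zero[of "cis (\<theta> i * y) - 1"] by linarith
    then show ?thesis using e[OF that] \<theta>[OF that] cmod_cis_minus[of "\<theta> i * y"] by auto
  qed
  then have "(\<Sum>i<l. cmod (cis (e i * \<theta> i * y) - 1)) \<le> l * \<tau>"
    using sum_bounded_above[of "{..<l}" "\<lambda>i. cmod (cis (e i * \<theta> i * y) - 1)" \<tau>] by simp
  then have "cmod (cis (\<Sum>i<l. e i * \<theta> i * y) - 1) \<le> l * \<tau>"
    using cmod_cis_sum[of "{..<l}" "\<lambda>i. e i * \<theta> i * y"] by simp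
  moreover have "cmod (cis (\<gamma> * y + - (\<gamma>' * y)) - 1) \<le> \<delta> + \<delta>"
    using order.trans[OF cmod_cis_add add_mono[OF P[OF \<gamma>(1)]]] P[OF \<gamma>(2)]
    by (simp only: cmod_cis_minus)
  ultimately show ?thesis
    unfolding ty mult_2
    by (rule order.trans[OF cmod_cis_add[of "\<Sum>i<l. e i * \<theta> i * y"] add_mono])
qed


section \<open>The density increment\<close>

lemma ap3_free_midpoint:
  assumes "ap3_free A" "x \<in> A" "y \<in> A" "z \<in> A" "x + z = 2 * y"
  shows "x = y"
proof (rule ccontr)
  assume "x \<noteq> y"
  moreover have z: "z = x + 2 * (y - x)" using assms(5) by simp
  ultimately have "nontrivial_3ap_in A (x, x + (y - x), x + 2 * (y - x))"
    unfolding nontrivial_3ap_in_def using assms(2,3) assms(4)[unfolded z]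
    by - (rule exI[of _ x], rule exI[of _ "y - x"], simp)
  with assms(1) show False unfolding ap3_free_def by blast
qed

text \<open>
  Translations let a Bohr set be recentred. The factor 2 is needed because the spectrum is that of the
  set of differences \<open>2 y\<close>, where \<open>y\<close> is the middle term of a progression.
\<close>

lemma ap3_free_affine_preimage:
  assumes "ap3_free A" "s \<noteq> 0"
  shows "ap3_free {y. u + s * y \<in> A}"
proof -
  have "r = 0" if "x \<in> {y. u + s * y \<in> A}" "x + r \<in> {y. u + s * y \<in> A}" "x + 2 * r \<in> {y. u + s * y \<in> A}" for x r
  proof -
    have "u + s * x = u + s * (x + r)"
    proof (rule ap3_free_midpoint[OF assms(1)])
      show "u + s * (x + 2 * r) \<in> A" using that(3) by simp
      show "u + s * x + (u + s * (x + 2 * r)) = 2 * (u + s * (x + r))" by (simp add: algebra_simps)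
    qed (use that in simp_all)
    then show ?thesis using assms(2) by simp
  qed
  then show ?thesis unfolding ap3_free_def nontrivial_3ap_in_def by blast
qed

lemma card_Int_le_of_subset:
  assumes "finite B" "B' \<subseteq> B"
  shows "real (card (A \<inter> B)) \<le> real (card (A \<inter> B')) + (real (card B) - real (card B'))"
proof -
  have fin': "finite B'" using assms finite_subset by blast
  have "card (A \<inter> B) \<le> card (A \<inter> B' \<union> (B - B'))"
    using assms fin' by (intro card_mono) auto
  also have "\<dots> \<le> card (A \<inter> B') + card (B - B')" by (rule card_Un_le)
  also have "card (B - B') = card B - card B'" using assms fin' by (intro card_Diff_subset) auto
  finally show ?thesis using card_mono[OF assms] by simp
qed

text \<open>
  Double counting pairs \<open>(x, y)\<close> with \<open>x + y \<in> A\<close>: for every fixed \<open>y\<close> the part of \<open>A\<close> well inside the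
  regular Bohr set is reached.
\<close>

lemma average_density_on_translates:
  fixes A :: "int set" and a :: real
  assumes reg: "regular N \<Lambda> \<epsilon> \<kappa> \<rho>" and N: "N \<ge> 0" and \<rho>: "\<rho> \<ge> 0" and \<epsilon>: "\<epsilon> \<ge> 0" and \<kappa>: "\<kappa> \<ge> 0"
    and dens: "real (card (A \<inter> bohr N \<Lambda> \<rho>)) \<ge> a * card (bohr N \<Lambda> \<rho>)"
    and \<sigma>: "\<sigma> \<le> \<kappa> * \<rho>"
  shows "(\<Sum>x\<in>bohr N \<Lambda> \<rho>. real (card {y\<in>bohr N \<Lambda> \<sigma>. x + y \<in> A}))
           \<ge> (a - \<epsilon>) * card (bohr N \<Lambda> \<rho>) * card (bohr N \<Lambda> \<sigma>)"
proof -
  let ?B = "bohr N \<Lambda> \<rho>" and ?I = "bohr N \<Lambda> ((1 - \<kappa>) * \<rho>)" and ?S = "bohr N \<Lambda> \<sigma>"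
  have IB: "?I \<subseteq> ?B" using \<kappa> \<rho> N by (intro bohr_mono) (auto simp: left_diff_distrib)
  have inner: "(a - \<epsilon>) * card ?B \<le> real (card (A \<inter> ?I))"
  proof -
    have "real (card (A \<inter> ?B)) \<le> real (card (A \<inter> ?I)) + (real (card ?B) - real (card ?I))"
      by (rule card_Int_le_of_subset[OF finite_bohr IB])
    then show ?thesis using dens regular_inner[OF reg N \<rho> \<kappa> \<epsilon>] by (simp add: algebra_simps)
  qed
  have "(a - \<epsilon>) * card ?B * card ?S \<le> real (card (A \<inter> ?I)) * card ?S"
    using inner by (intro mult_right_mono) auto
  also have "\<dots> = (\<Sum>y\<in>?S. real (card (A \<inter> ?I)))" by simp
  also have "\<dots> \<le> (\<Sum>y\<in>?S. real (card {x\<in>?B. x + y \<in> A}))"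
  proof (intro sum_mono of_nat_mono)
    fix y assume y: "y \<in> ?S"
    have "(\<lambda>z. z - y) ` (A \<inter> ?I) \<subseteq> {x\<in>?B. x + y \<in> A}"
    proof clarify
      fix z assume z: "z \<in> A" "z \<in> ?I"
      have "z - y \<in> bohr N \<Lambda> ((1 - \<kappa>) * \<rho> + \<sigma>)" using z y bohr_diff by blast
      moreover have "(1 - \<kappa>) * \<rho> + \<sigma> \<le> \<rho>" using \<sigma> by (simp add: left_diff_distrib)
      ultimately have "z - y \<in> ?B" using bohr_mono[of _ _ N \<Lambda> \<Lambda>] N by blast
      then show "z - y \<in> ?B \<and> z - y + y \<in> A" using z by simp
    qed
    then have "card ((\<lambda>z. z - y) ` (A \<inter> ?I)) \<le> card {x\<in>?B. x + y \<in> A}" by (intro card_mono) auto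
    then show "card (A \<inter> ?I) \<le> card {x\<in>?B. x + y \<in> A}"
      by (subst (asm) card_image) (auto simp: inj_on_def)
  qed
  also have "\<dots> = (\<Sum>y\<in>?S. \<Sum>x\<in>?B. of_bool (x + y \<in> A))"
    by (simp add: sum.If_cases of_bool_def Int_def)
  also have "\<dots> = (\<Sum>x\<in>?B. \<Sum>y\<in>?S. of_bool (x + y \<in> A))" by (rule sum.swap)
  also have "\<dots> = (\<Sum>x\<in>?B. real (card {y\<in>?S. x + y \<in> A}))"
    by (simp add: sum.If_cases of_bool_def Int_def)
  finally show ?thesis .
qed

text \<open>
  The two average densities add up to at least \<open>2 (a - \<epsilon>)\<close>, so one and the same \<open>x\<close> makes the sum of the two densities that
  large. Unless one of them exceeds \<open>a\<close> substantially, both are then close to \<open>a\<close>.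
\<close>

lemma common_dense_translate:
  fixes A :: "int set" and a :: real
  assumes reg: "regular N \<Lambda> \<epsilon> \<kappa> \<rho>" and N: "N \<ge> 0" and \<rho>: "\<rho> \<ge> 0" and \<epsilon>: "\<epsilon> \<ge> 0" and \<kappa>: "\<kappa> \<ge> 0"
    and dens: "real (card (A \<inter> bohr N \<Lambda> \<rho>)) \<ge> a * card (bohr N \<Lambda> \<rho>)"
    and \<sigma>: "0 \<le> \<sigma>" "\<sigma> \<le> \<kappa> * \<rho>" and \<tau>: "0 \<le> \<tau>" "\<tau> \<le> \<kappa> * \<rho>"
  obtains x where "2 * (a - \<epsilon>) \<le> real (card {y\<in>bohr N \<Lambda> \<sigma>. x + y \<in> A}) / card (bohr N \<Lambda> \<sigma>)
      + real (card {y\<in>bohr N \<Lambda> \<tau>. x + y \<in> A}) / card (bohr N \<Lambda> \<tau>)"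
proof -
  let ?B = "bohr N \<Lambda> \<rho>" and ?S = "bohr N \<Lambda> \<sigma>" and ?T = "bohr N \<Lambda> \<tau>"
  define d where "d x = real (card {y\<in>?S. x + y \<in> A}) / card ?S + real (card {y\<in>?T. x + y \<in> A}) / card ?T" for x
  have pos: "card ?B > 0" "card ?S > 0" "card ?T > 0" using card_bohr_pos \<rho> N \<sigma> \<tau> by blast+
  have "(a - \<epsilon>) * card ?B \<le> (\<Sum>x\<in>?B. real (card {y\<in>?S. x + y \<in> A})) / card ?S"
    using average_density_on_translates[OF reg N \<rho> \<epsilon> \<kappa> dens \<sigma>(2)] pos by (simp add: pos_le_divide_eq)
  moreover have "(a - \<epsilon>) * card ?B \<le> (\<Sum>x\<in>?B. real (card {y\<in>?T. x + y \<in> A})) / card ?T"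
    using average_density_on_translates[OF reg N \<rho> \<epsilon> \<kappa> dens \<tau>(2)] pos by (simp add: pos_le_divide_eq)
  ultimately have sum: "(\<Sum>x\<in>?B. 2 * (a - \<epsilon>)) \<le> (\<Sum>x\<in>?B. d x)"
    unfolding d_def sum.distrib by (simp add: sum_divide_distrib algebra_simps)
  have "\<exists>x\<in>?B. 2 * (a - \<epsilon>) \<le> d x"
  proof (rule ccontr)
    assume "\<not> ?thesis"
    then have "(\<Sum>x\<in>?B. d x) < (\<Sum>x\<in>?B. 2 * (a - \<epsilon>))"
      using pos by (intro sum_strict_mono) (auto simp: not_le card_gt_0_iff)
    with sum show False by simp
  qed
  then show thesis using that unfolding d_def by blast
qed

text \<open>
  For fixed \<open>y\<close>, expand the sum of \<open>f x * f (2 y - x)\<close> into the terms with two, one and no indicator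
  functions. The first counts progressions centred at \<open>y\<close>, hence is at most 1. Because \<open>B\<close> is nearly
  invariant under \<open>x \<mapsto> 2 y - x\<close>, the remaining terms are \<open>- 2 \<alpha>\<^sup>2 + \<alpha>\<^sup>2\<close> times \<open>card B\<close>, up to a small error.
\<close>

lemma progression_free_fourier_mass:
  fixes A :: "int set" and \<alpha> :: real and N :: real and \<Lambda> :: "real set" and \<rho> \<sigma> :: real
  assumes free: "ap3_free A" and reg: "regular N \<Lambda> \<epsilon> \<kappa> \<rho>" and N: "N \<ge> 0" and \<rho>: "0 \<le> \<rho>" "\<rho> \<le> 2"
    and \<epsilon>: "\<epsilon> \<ge> 0" and \<kappa>: "\<kappa> \<ge> 0" and \<sigma>: "0 \<le> \<sigma>" "2 * \<sigma> \<le> \<kappa> * \<rho>" "\<sigma> \<le> 2"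
    and M: "real M > 8 * N"
  defines "B \<equiv> bohr N \<Lambda> \<rho>" and "A2 \<equiv> A \<inter> bohr N \<Lambda> \<sigma>"
  defines "\<alpha> \<equiv> card (A \<inter> B) / card B"
  defines "f \<equiv> (\<lambda>x. of_bool (x \<in> A) - \<alpha>)"
  assumes small: "8 * \<epsilon> \<le> \<alpha>" and big: "8 \<le> \<alpha>\<^sup>2 * card B"
  shows "\<alpha>\<^sup>2 / 2 * card B * card A2 * M
    \<le> (\<Sum>j<M. (cmod (\<Sum>x\<in>B. of_real (f x) * cis (root_angle M j * x)))\<^sup>2
              * cmod (\<Sum>y\<in>A2. cis (2 * root_angle M j * y)))"
proof -
  have pos: "card B > 0" unfolding B_def using card_bohr_pos \<rho> N by blast
  have finA2: "finite A2" by (simp add: A2_def)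
  have \<alpha>0: "\<alpha> \<ge> 0" by (simp add: \<alpha>_def)
  have cardA: "real (card (A \<inter> B)) = \<alpha> * card B" using pos by (simp add: \<alpha>_def)
  have per_y: "\<alpha>\<^sup>2 / 2 * card B \<le> - (\<Sum>x\<in>B. if 2 * y - x \<in> B then f x * f (2 * y - x) else 0)" if y: "y \<in> A2" for y
  proof -
    define B' where "B' = {x\<in>B. 2 * y - x \<in> B}"
    have yA: "y \<in> A" and yB: "y \<in> bohr N \<Lambda> \<sigma>" using y by (auto simp: A2_def)
    have B': "finite B'" "B' \<subseteq> B" by (auto simp: B'_def B_def)
    have "bohr N \<Lambda> ((1 - \<kappa>) * \<rho>) \<subseteq> B'"
    proof
      fix x assume x: "x \<in> bohr N \<Lambda> ((1 - \<kappa>) * \<rho>)"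
      have "y + y \<in> bohr N \<Lambda> (\<kappa> * \<rho>)"
        using bohr_add[OF yB yB] bohr_mono[of "\<sigma> + \<sigma>" "\<kappa> * \<rho>" N \<Lambda> \<Lambda>] \<sigma> N by auto
      from bohr_diff[OF this x] have "2 * y - x \<in> B" by (simp add: B_def algebra_simps)
      moreover have "x \<in> B" using x bohr_mono[of "(1 - \<kappa>) * \<rho>" \<rho> N \<Lambda> \<Lambda>] \<kappa> \<rho> N
        by (auto simp: B_def left_diff_distrib)
      ultimately show "x \<in> B'" by (simp add: B'_def)
    qed
    then have "card (bohr N \<Lambda> ((1 - \<kappa>) * \<rho>)) \<le> card B'" by (intro card_mono B')
    then have cB': "(1 - \<epsilon>) * card B \<le> card B'"
      using regular_inner[OF reg N \<rho>(1) \<kappa> \<epsilon>] by (simp add: B_def)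
    have cAB': "(\<alpha> - \<epsilon>) * card B \<le> real (card (A \<inter> B'))"
    proof -
      have "real (card (A \<inter> B)) \<le> real (card (A \<inter> B')) + (real (card B) - real (card B'))"
        using B'(2) by (intro card_Int_le_of_subset) (simp add: B_def)
      then show ?thesis using cB' cardA by (simp add: algebra_simps)
    qed
    have refl: "(\<Sum>x\<in>B'. of_bool (2 * y - x \<in> A)) = (\<Sum>x\<in>B'. of_bool (x \<in> A) :: real)"
      by (rule sum.reindex_bij_witness[of _ "\<lambda>x. 2 * y - x" "\<lambda>x. 2 * y - x"]) (auto simp: B'_def)
    have s1: "(\<Sum>x\<in>B'. of_bool (x \<in> A) :: real) = card (A \<inter> B')"
      using B' by (simp add: of_bool_def sum.If_cases Int_def conj_commute)
    have s2: "(\<Sum>x\<in>B'. of_bool (x \<in> A) * of_bool (2 * y - x \<in> A)) \<le> (1::real)"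
    proof -
      have "(\<Sum>x\<in>B'. of_bool (x \<in> A) * of_bool (2 * y - x \<in> A) :: real) \<le> (\<Sum>x\<in>B'. of_bool (x = y))"
        using ap3_free_midpoint[OF free _ yA] by (intro sum_mono) auto
      also have "\<dots> \<le> 1" using B' by (simp add: of_bool_def sum.delta)
      finally show ?thesis .
    qed
    have "(\<Sum>x\<in>B. if 2 * y - x \<in> B then f x * f (2 * y - x) else 0) = (\<Sum>x\<in>B'. f x * f (2 * y - x))"
      unfolding B'_def by (rule sum.inter_filter[symmetric]) (simp add: B_def)
    also have "\<dots> = (\<Sum>x\<in>B'. of_bool (x \<in> A) * of_bool (2 * y - x \<in> A))
        - \<alpha> * (\<Sum>x\<in>B'. of_bool (x \<in> A)) - \<alpha> * (\<Sum>x\<in>B'. of_bool (2 * y - x \<in> A)) + \<alpha>\<^sup>2 * card B'"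
      by (simp add: f_def left_diff_distrib right_diff_distrib sum_subtractf sum.distrib
          sum_distrib_left power2_eq_square mult_ac)
    also have "\<dots> \<le> 1 - 2 * \<alpha> * ((\<alpha> - \<epsilon>) * card B) + \<alpha>\<^sup>2 * card B"
    proof -
      have "\<alpha> * ((\<alpha> - \<epsilon>) * card B) \<le> \<alpha> * card (A \<inter> B')" using cAB' \<alpha>0 by (intro mult_left_mono)
      moreover have "\<alpha>\<^sup>2 * card B' \<le> \<alpha>\<^sup>2 * card B"
        using B' by (intro mult_left_mono of_nat_mono card_mono) (auto simp: B_def)
      ultimately show ?thesis using s2 unfolding refl s1 by linarith
    qed
    also have "\<dots> = 1 - \<alpha>\<^sup>2 * card B + 2 * \<alpha> * card B * \<epsilon>" by (simp add: algebra_simps power2_eq_square)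
    also have "2 * \<alpha> * card B * \<epsilon> \<le> 2 * \<alpha> * card B * (\<alpha> / 8)"
      using small \<alpha>0 by (intro mult_left_mono) auto
    also have "1 - \<alpha>\<^sup>2 * card B + 2 * \<alpha> * card B * (\<alpha> / 8) \<le> - (\<alpha>\<^sup>2 / 2 * card B)"
      using big by (simp add: power2_eq_square)
    finally show ?thesis by simp
  qed
  have "\<alpha>\<^sup>2 / 2 * card B * card A2 = (\<Sum>y\<in>A2. \<alpha>\<^sup>2 / 2 * card B)" by simp
  also have "\<dots> \<le> (\<Sum>y\<in>A2. - (\<Sum>x\<in>B. if 2 * y - x \<in> B then f x * f (2 * y - x) else 0))"
    by (intro sum_mono per_y)
  also have "\<dots> \<le> \<bar>\<Sum>y\<in>A2. \<Sum>x\<in>B. if 2 * y - x \<in> B then f x * f (2 * y - x) else 0\<bar>"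
    by (simp add: sum_negf)
  finally have "\<alpha>\<^sup>2 / 2 * card B * card A2 * M
      \<le> M * \<bar>\<Sum>y\<in>A2. \<Sum>x\<in>B. if 2 * y - x \<in> B then f x * f (2 * y - x) else 0\<bar>"
    by (subst mult.commute) (intro mult_left_mono, auto)
  also have "\<dots> \<le> (\<Sum>j<M. (cmod (\<Sum>x\<in>B. of_real (f x) * cis (root_angle M j * x)))\<^sup>2
              * cmod (\<Sum>y\<in>A2. cis (2 * root_angle M j * y)))"
  proof (rule weighted_midpoint_sum_fourier)
    show "M > 0" using M N by (intro Nat.gr0I) auto
    show "finite B" "finite A2" by (auto simp: B_def A2_def)
    fix x y z assume "x \<in> B" "z \<in> B" "y \<in> A2"
    then have "\<bar>real_of_int x\<bar> \<le> \<rho> * N" "\<bar>real_of_int z\<bar> \<le> \<rho> * N" "\<bar>real_of_int y\<bar> \<le> \<sigma> * N"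
      by (auto simp: B_def A2_def bohr_def)
    moreover have "\<rho> * N \<le> 2 * N" "\<sigma> * N \<le> 2 * N" using \<rho> \<sigma> N by (auto intro: mult_right_mono)
    ultimately have "real_of_int \<bar>x + z - 2 * y\<bar> < real M" using M by simp
    then show "\<bar>x + z - 2 * y\<bar> < int M" by linarith
  qed
  finally show ?thesis .
qed

text \<open>
  Summing over \<open>x\<close> first: for each \<open>y\<close> the points \<open>x + 2 y\<close> run over all of \<open>B\<close>.
\<close>

lemma sum_dilated_translates:
  fixes h k :: "int \<Rightarrow> 'x::comm_ring_1"
  assumes I: "finite I" and shift: "\<And>z y. z \<in> B \<Longrightarrow> y \<in> T \<Longrightarrow> z - 2 * y \<in> I"
    and h0: "\<And>z. z \<notin> B \<Longrightarrow> h z = 0"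
  shows "(\<Sum>x\<in>I. \<Sum>y\<in>T. h (x + 2 * y) * k y) = (\<Sum>y\<in>T. (\<Sum>z\<in>B. h z) * k y)"
proof -
  have "(\<Sum>x\<in>I. h (x + 2 * y)) = (\<Sum>z\<in>B. h z)" if y: "y \<in> T" for y
  proof -
    have "(\<Sum>z\<in>B. h z) = (\<Sum>x\<in>(\<lambda>z. z - 2 * y) ` B. h (x + 2 * y))"
      by (subst sum.reindex) (auto simp: inj_on_def)
    also have "\<dots> = (\<Sum>x\<in>I. h (x + 2 * y))"
    proof (rule sum.mono_neutral_left[OF I])
      show "(\<lambda>z. z - 2 * y) ` B \<subseteq> I" using shift y by auto
      show "\<forall>x\<in>I - (\<lambda>z. z - 2 * y) ` B. h (x + 2 * y) = 0"
      proof
        fix x assume "x \<in> I - (\<lambda>z. z - 2 * y) ` B"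
        then have "x + 2 * y \<notin> B" by (auto simp: image_iff)
        then show "h (x + 2 * y) = 0" by (rule h0)
      qed
    qed
    finally show ?thesis by simp
  qed
  then show ?thesis by (subst sum.swap) (simp add: sum_distrib_right[symmetric])
qed

text \<open>
  Let \<open>E x\<close> and \<open>H x\<close> be the proportions of \<open>y \<in> T\<close> with \<open>x + 2 y\<close> in \<open>A \<inter> B\<close> and in \<open>B\<close>. Characters in \<open>D\<close> hardly
  oscillate on \<open>2 T\<close>, so \<open>E - \<alpha> H\<close>, the average of \<open>f\<close> along \<open>2 T\<close>, keeps at least a quarter of their mass in
  \<open>L\<^sup>2\<close>. Since \<open>H\<close> is essentially the indicator function of \<open>B\<close>, expanding the square shows that
  \<open>\<Sum> E\<^sup>2\<close> is at least \<open>(1 + c / 4) * \<alpha> * \<Sum> E\<close>, up to a term with \<open>\<epsilon>\<close>; so some \<open>E x\<close> is large.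
\<close>

lemma fourier_mass_density_increment:
  fixes A T :: "int set" and \<alpha> :: real and N :: real and \<Lambda> :: "real set" and \<rho> c :: real
  assumes reg: "regular N \<Lambda> \<epsilon> \<kappa> \<rho>" and N: "N \<ge> 0" and \<rho>: "0 \<le> \<rho>" "\<rho> \<le> 2"
    and \<epsilon>: "\<epsilon> \<ge> 0" and \<kappa>: "\<kappa> \<ge> 0"
    and T: "finite T" "T \<noteq> {}" "\<And>y. y \<in> T \<Longrightarrow> 2 * y \<in> bohr N \<Lambda> (\<kappa> * \<rho> / 2)" "\<And>y. y \<in> T \<Longrightarrow> \<bar>real_of_int y\<bar> \<le> 2 * N"
    and M: "real M > 12 * N"
  defines "B \<equiv> bohr N \<Lambda> \<rho>"
  defines "\<alpha> \<equiv> card (A \<inter> B) / card B"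
  defines "f \<equiv> (\<lambda>x. of_bool (x \<in> A) - \<alpha>)"
  assumes D: "D \<subseteq> {..<M}" "\<And>j. j \<in> D \<Longrightarrow> cmod (\<Sum>y\<in>T. cis (2 * root_angle M j * y)) \<ge> card T / 2"
    and mass: "c * \<alpha>\<^sup>2 * card B * M \<le> (\<Sum>j\<in>D. (cmod (\<Sum>x\<in>B. of_real (f x) * cis (root_angle M j * x)))\<^sup>2)"
    and \<alpha>pos: "\<alpha> > 0"
  obtains x where "(\<alpha> * (1 + c / 4) - 2 * \<epsilon>) * card T \<le> card {y\<in>T. x + 2 * y \<in> A}"
proof -
  let ?t = "root_angle M"
  define b where "b = real (card T)"
  have b: "b > 0" using T by (simp add: b_def card_gt_0_iff)
  have finB: "finite B" by (simp add: B_def)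
  have pos: "card B > 0" unfolding B_def using card_bohr_pos \<rho> N by blast
  have cardA: "real (card (A \<inter> B)) = \<alpha> * card B" using pos by (simp add: \<alpha>_def)
  have M0: "M > 0" using M N by (intro Nat.gr0I) auto
  define I where "I = bohr N {} 6"
  have finI: "finite I" by (simp add: I_def)
  have shift_I: "z - 2 * y \<in> I" if "z \<in> B" "y \<in> T" for z y
  proof -
    have "\<bar>real_of_int z\<bar> \<le> \<rho> * N" using that by (auto simp: B_def bohr_def)
    moreover have "\<rho> * N \<le> 2 * N" using \<rho> N by (intro mult_right_mono)
    ultimately show ?thesis using T(4)[OF that(2)] by (simp add: I_def bohr_def)
  qed
  define F where "F z = (if z \<in> B then f z else 0)" for z
  define E where "E x = real (card {y\<in>T. x + 2 * y \<in> A \<inter> B}) / b" for x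
  define H where "H x = real (card {y\<in>T. x + 2 * y \<in> B}) / b" for x
  note sumT = sum_dilated_translates[OF finI shift_I]
  have card_sum: "real (card {y\<in>T. x + 2 * y \<in> R}) = (\<Sum>y\<in>T. of_bool (x + 2 * y \<in> R))" for x R
    using T(1) by (simp add: of_bool_def sum.If_cases Int_def)
  have sumE: "(\<Sum>x\<in>I. E x) = \<alpha> * card B"
  proof -
    have "(\<Sum>x\<in>I. E x) = (\<Sum>x\<in>I. \<Sum>y\<in>T. of_bool (x + 2 * y \<in> A \<inter> B) * 1) / b"
      by (simp only: E_def card_sum sum_divide_distrib mult_1_right)
    also have "\<dots> = (\<Sum>y\<in>T. (\<Sum>z\<in>B. of_bool (z \<in> A \<inter> B)) * 1) / b"
      by (subst sumT) auto
    also have "(\<Sum>z\<in>B. of_bool (z \<in> A \<inter> B)) = real (card (A \<inter> B))"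
      using finB by (simp add: of_bool_def sum.If_cases Int_def conj_commute)
    finally show ?thesis using b by (simp add: cardA b_def)
  qed
  have sumH: "(\<Sum>x\<in>I. H x) = card B"
  proof -
    have "(\<Sum>x\<in>I. H x) = (\<Sum>x\<in>I. \<Sum>y\<in>T. of_bool (x + 2 * y \<in> B) * 1) / b"
      by (simp only: H_def card_sum sum_divide_distrib mult_1_right)
    also have "\<dots> = (\<Sum>y\<in>T. (\<Sum>z\<in>B. of_bool (z \<in> B)) * 1) / b"
      by (subst sumT) auto
    finally show ?thesis using b by (simp add: b_def)
  qed
  have E0: "E x \<ge> 0" and H0: "H x \<ge> 0" and H1: "H x \<le> 1" for x
  proof -
    show "E x \<ge> 0" "H x \<ge> 0" using b by (auto simp: E_def H_def)
    have "card {y\<in>T. x + 2 * y \<in> B} \<le> card T" using T(1) by (intro card_mono) auto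
    then show "H x \<le> 1" using b by (simp add: H_def b_def)
  qed
  have sumHH: "(\<Sum>x\<in>I. (H x)\<^sup>2) \<le> card B"
  proof -
    have "(\<Sum>x\<in>I. (H x)\<^sup>2) \<le> (\<Sum>x\<in>I. H x)"
      using H0 H1 by (intro sum_mono) (simp add: power2_eq_square mult_left_le)
    then show ?thesis by (simp add: sumH)
  qed
  have sumEH: "(\<Sum>x\<in>I. E x * H x) \<ge> (\<alpha> - \<epsilon>) * card B"
  proof -
    let ?Q = "bohr N \<Lambda> ((1 - \<kappa>) * \<rho>)" and ?P = "bohr N \<Lambda> (\<rho> - \<kappa> * \<rho> / 2)"
    have \<kappa>\<rho>: "\<kappa> * \<rho> \<ge> 0" using \<kappa> \<rho> by simp
    have PB: "?P \<subseteq> B" unfolding B_def using \<kappa>\<rho> N by (intro bohr_mono) auto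
    have QB: "?Q \<subseteq> B" unfolding B_def using \<kappa>\<rho> N by (intro bohr_mono) (auto simp: left_diff_distrib)
    have HP: "H x = 1" if "x \<in> ?P" for x
    proof -
      have "x + 2 * y \<in> B" if "y \<in> T" for y
        using bohr_add[OF \<open>x \<in> ?P\<close> T(3)[OF that]] by (simp add: B_def)
      then have "{y\<in>T. x + 2 * y \<in> B} = T" by auto
      then show ?thesis using b by (simp add: H_def b_def)
    qed
    have "real (card (A \<inter> B)) \<le> real (card (A \<inter> ?Q)) + (real (card B) - real (card ?Q))"
      by (rule card_Int_le_of_subset[OF finB QB])
    then have "(\<alpha> - \<epsilon>) * card B \<le> real (card (A \<inter> ?Q))"
      using regular_inner[OF reg N \<rho>(1) \<kappa> \<epsilon>] cardA by (simp add: B_def algebra_simps)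
    also have "\<dots> = (\<Sum>y\<in>T. real (card (A \<inter> ?Q))) / b" using b by (simp add: b_def)
    also have "\<dots> \<le> (\<Sum>y\<in>T. \<Sum>x\<in>I \<inter> ?P. of_bool (x + 2 * y \<in> A \<inter> B)) / b"
    proof (intro divide_right_mono sum_mono)
      fix y assume y: "y \<in> T"
      have "(\<lambda>z. z - 2 * y) ` (A \<inter> ?Q) \<subseteq> {x\<in>I \<inter> ?P. x + 2 * y \<in> A \<inter> B}"
      proof clarify
        fix z assume z: "z \<in> A" "z \<in> ?Q"
        have "z - 2 * y \<in> ?P" using bohr_diff[OF z(2) T(3)[OF y]] by (simp add: algebra_simps)
        moreover have "z - 2 * y \<in> I" using shift_I z y QB by blast
        ultimately show "z - 2 * y \<in> I \<inter> ?P \<and> z - 2 * y + 2 * y \<in> A \<inter> B" using z QB by auto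
      qed
      then have "card ((\<lambda>z. z - 2 * y) ` (A \<inter> ?Q)) \<le> card {x\<in>I \<inter> ?P. x + 2 * y \<in> A \<inter> B}"
        using finI by (intro card_mono) auto
      then have "card (A \<inter> ?Q) \<le> card {x\<in>I \<inter> ?P. x + 2 * y \<in> A \<inter> B}"
        by (subst (asm) card_image) (auto simp: inj_on_def)
      also have "real \<dots> = (\<Sum>x\<in>I \<inter> ?P. of_bool (x + 2 * y \<in> A \<inter> B))"
        using finI by (simp add: of_bool_def sum.If_cases Int_def)
      finally show "real (card (A \<inter> ?Q)) \<le> (\<Sum>x\<in>I \<inter> ?P. of_bool (x + 2 * y \<in> A \<inter> B))" by simp
    qed (use b in auto)
    also have "\<dots> = (\<Sum>x\<in>I \<inter> ?P. (\<Sum>y\<in>T. of_bool (x + 2 * y \<in> A \<inter> B)) / b)"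
      unfolding sum_divide_distrib[of _ "I \<inter> ?P", symmetric] by (subst sum.swap) (rule refl)
    also have "\<dots> = (\<Sum>x\<in>I \<inter> ?P. E x * H x)"
    proof (intro sum.cong refl)
      fix x assume "x \<in> I \<inter> ?P"
      then have "H x = 1" using HP by blast
      then show "(\<Sum>y\<in>T. of_bool (x + 2 * y \<in> A \<inter> B)) / b = E x * H x"
        by (simp only: E_def card_sum mult_1_right)
    qed
    also have "\<dots> \<le> (\<Sum>x\<in>I. E x * H x)"
      using finI E0 H0 by (intro sum_mono2) auto
    finally show ?thesis .
  qed
  have g_eq: "(\<Sum>y\<in>T. F (x + 2 * y)) / b = E x - \<alpha> * H x" for x
  proof -
    have "F z = of_bool (z \<in> A \<inter> B) - \<alpha> * of_bool (z \<in> B)" for z by (auto simp: F_def f_def)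
    then show ?thesis
      by (simp only: E_def H_def card_sum sum_subtractf sum_distrib_left[symmetric] diff_divide_distrib) simp
  qed
  have g_hat: "cmod (\<Sum>x\<in>I. of_real (E x - \<alpha> * H x) * cis (?t j * x))
      = cmod (\<Sum>x\<in>B. of_real (f x) * cis (?t j * x)) * cmod (\<Sum>y\<in>T. cis (2 * ?t j * y)) / b" for j
  proof -
    have "(\<Sum>x\<in>I. of_real (E x - \<alpha> * H x) * cis (?t j * x))
        = (\<Sum>x\<in>I. \<Sum>y\<in>T. (of_real (F (x + 2 * y)) * cis (?t j * real_of_int (x + 2 * y))) * cis (- (2 * ?t j * y))) / b"
      unfolding g_eq[symmetric] sum_divide_distrib of_real_sum sum_distrib_right
      by (intro sum.cong refl) (simp add: mult.assoc cis_mult algebra_simps)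
    also have "\<dots> = (\<Sum>y\<in>T. (\<Sum>z\<in>B. of_real (F z) * cis (?t j * real_of_int z)) * cis (- (2 * ?t j * y))) / b"
      by (subst sumT[where h = "\<lambda>z. of_real (F z) * cis (?t j * real_of_int z)"]) (auto simp: F_def)
    also have "\<dots> = (\<Sum>x\<in>B. of_real (f x) * cis (?t j * x)) * cnj (\<Sum>y\<in>T. cis (2 * ?t j * y)) / b"
      by (simp add: sum_distrib_left F_def cis_cnj)
    finally show ?thesis using b by (simp only: norm_mult norm_divide complex_mod_cnj) simp
  qed
  have "c * \<alpha>\<^sup>2 * card B * M / 4 \<le> (\<Sum>j\<in>D. (cmod (\<Sum>x\<in>B. of_real (f x) * cis (?t j * x)))\<^sup>2) / 4"
    using mass by simp
  also have "\<dots> \<le> (\<Sum>j\<in>D. (cmod (\<Sum>x\<in>I. of_real (E x - \<alpha> * H x) * cis (?t j * x)))\<^sup>2)"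
    unfolding sum_divide_distrib
  proof (intro sum_mono)
    fix j assume j: "j \<in> D"
    let ?f = "cmod (\<Sum>x\<in>B. of_real (f x) * cis (?t j * x))" and ?T = "cmod (\<Sum>y\<in>T. cis (2 * ?t j * y))"
    have "1/2 \<le> ?T / b" using D(2)[OF j] b by (simp add: b_def field_simps)
    then have "?f * (1/2) \<le> ?f * (?T / b)" by (intro mult_left_mono) auto
    then have "(?f * (1/2))\<^sup>2 \<le> (?f * (?T / b))\<^sup>2" by (intro power_mono) auto
    then show "?f\<^sup>2 / 4 \<le> (cmod (\<Sum>x\<in>I. of_real (E x - \<alpha> * H x) * cis (?t j * x)))\<^sup>2"
      unfolding g_hat by (simp add: power2_eq_square)
  qed
  also have "\<dots> \<le> (\<Sum>j<M. (cmod (\<Sum>x\<in>I. of_real (E x - \<alpha> * H x) * cis (?t j * x)))\<^sup>2)"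
    using D(1) by (intro sum_mono2) auto
  also have "\<dots> = M * (\<Sum>x\<in>I. (cmod (complex_of_real (E x - \<alpha> * H x)))\<^sup>2)"
  proof (rule parseval_ints[OF M0 finI])
    fix x y assume "x \<in> I" "y \<in> I"
    then have "\<bar>real_of_int x\<bar> \<le> 6 * N" "\<bar>real_of_int y\<bar> \<le> 6 * N" by (auto simp: I_def bohr_def)
    then have "real_of_int \<bar>x - y\<bar> < real M" using M by simp
    then show "\<bar>x - y\<bar> < int M" by linarith
  qed
  finally have "M * (c * \<alpha>\<^sup>2 * card B / 4) \<le> M * (\<Sum>x\<in>I. (cmod (complex_of_real (E x - \<alpha> * H x)))\<^sup>2)"
    by (simp add: mult_ac)
  then have "c * \<alpha>\<^sup>2 * card B / 4 \<le> (\<Sum>x\<in>I. (cmod (complex_of_real (E x - \<alpha> * H x)))\<^sup>2)"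
    using M0 by (simp only: mult_le_cancel_left_pos of_nat_0_less_iff)
  also have "(\<Sum>x\<in>I. (cmod (complex_of_real (E x - \<alpha> * H x)))\<^sup>2)
      = (\<Sum>x\<in>I. (E x)\<^sup>2) - 2 * \<alpha> * (\<Sum>x\<in>I. E x * H x) + \<alpha>\<^sup>2 * (\<Sum>x\<in>I. (H x)\<^sup>2)"
    unfolding norm_of_real power2_abs power2_diff
    by (simp add: sum.distrib sum_subtractf sum_distrib_left power_mult_distrib mult_ac)
  also have "\<dots> \<le> (\<Sum>x\<in>I. (E x)\<^sup>2) - 2 * \<alpha> * ((\<alpha> - \<epsilon>) * card B) + \<alpha>\<^sup>2 * card B"
    using sumEH sumHH \<alpha>pos by (intro add_mono diff_mono mult_left_mono order.refl) auto
  finally have "c * \<alpha>\<^sup>2 * card B / 4 \<le> (\<Sum>x\<in>I. (E x)\<^sup>2) - 2 * \<alpha> * ((\<alpha> - \<epsilon>) * card B) + \<alpha>\<^sup>2 * card B" .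
  then have energy: "(\<alpha> * (1 + c / 4) - 2 * \<epsilon>) * (\<alpha> * card B) \<le> (\<Sum>x\<in>I. (E x)\<^sup>2)"
    by (simp add: algebra_simps power2_eq_square)
  have "\<exists>x\<in>I. \<alpha> * (1 + c / 4) - 2 * \<epsilon> \<le> E x"
  proof (rule ccontr)
    assume "\<not> ?thesis"
    then have less: "E x < \<alpha> * (1 + c / 4) - 2 * \<epsilon>" if "x \<in> I" for x using that by (meson not_le)
    have "\<alpha> * card B > 0" using \<alpha>pos pos by simp
    then have "\<not> (\<forall>x\<in>I. E x \<le> 0)" using sumE sum_nonpos[of I E] by auto
    then obtain x0 where x0: "x0 \<in> I" "E x0 > 0" by (auto simp: not_le)
    have "(\<Sum>x\<in>I. (E x)\<^sup>2) < (\<Sum>x\<in>I. E x * (\<alpha> * (1 + c / 4) - 2 * \<epsilon>))"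
    proof (rule sum_strict_mono_ex1[OF finI])
      show "\<forall>x\<in>I. (E x)\<^sup>2 \<le> E x * (\<alpha> * (1 + c / 4) - 2 * \<epsilon>)"
        unfolding power2_eq_square by (intro ballI mult_left_mono less_imp_le[OF less] E0)
      show "\<exists>x\<in>I. (E x)\<^sup>2 < E x * (\<alpha> * (1 + c / 4) - 2 * \<epsilon>)"
        using x0 less by (intro bexI[of _ x0]) (auto simp: power2_eq_square)
    qed
    also have "\<dots> = (\<alpha> * (1 + c / 4) - 2 * \<epsilon>) * (\<alpha> * card B)"
      unfolding sum_distrib_right[symmetric] sumE by simp
    finally show False using energy by simp
  qed
  then obtain x where x: "\<alpha> * (1 + c / 4) - 2 * \<epsilon> \<le> E x" by blast
  then have "(\<alpha> * (1 + c / 4) - 2 * \<epsilon>) * b \<le> card {y\<in>T. x + 2 * y \<in> A \<inter> B}"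
    using b by (simp add: E_def field_simps)
  also have "\<dots> \<le> card {y\<in>T. x + 2 * y \<in> A}"
    using T(1) by (intro of_nat_mono card_mono) auto
  finally show thesis using that[of x] by (simp add: b_def)
qed


lemma cnj_sgn_mult: "cnj (sgn z) * z = complex_of_real (cmod z)"
proof (cases "z = 0")
  case False
  have "cnj (sgn z) * z = (cnj z * z) / cmod z" by (simp add: sgn_eq)
  also have "cnj z * z = complex_of_real ((cmod z)\<^sup>2)" by (simp only: complex_norm_square mult.commute)
  finally show ?thesis using False by (simp add: power2_eq_square)
qed simp

text \<open>
  Four nested radii are used. On \<open>\<rho>1\<close> lives the balanced function, on \<open>\<rho>2\<close> the middle terms of the progressions;
  \<open>\<rho>3\<close> is the radius of the smoothing that decides which frequencies are negligible, and \<open>\<rho>'\<close> is the new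
  radius, so small that all \<open>l\<close> spanning frequencies together move by little. The weights \<open>p\<close> are the
  normalised squares of the transform of the balanced function. The largeness hypothesis excludes Bohr
  sets so small that the trivial progressions dominate.
\<close>

lemma density_increment_step:
  fixes A :: "int set" and \<Lambda> :: "real set" and N \<rho> a \<delta> \<epsilon> \<kappa> :: real and t m n L :: nat
  assumes free: "ap3_free A" and N: "N \<ge> 1" and fin: "finite \<Lambda>"
    and reg: "regular N \<Lambda> \<epsilon> \<kappa> \<rho>" and \<rho>: "0 < \<rho>" "\<rho> \<le> 2"
    and dens: "a * card (bohr N \<Lambda> \<rho>) \<le> card (A \<inter> bohr N \<Lambda> \<rho>)"
    and \<delta>: "0 < \<delta>" "\<delta> \<le> a" "\<delta> \<le> 1" and \<epsilon>: "0 < \<epsilon>" "\<epsilon> \<le> \<delta> / 10000"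
    and t: "t > 0" "\<kappa> = 1 / (4 * real t)" "(1 + \<epsilon>) ^ t > 81 ^ (card \<Lambda> + n + 1)"
    and m: "m > 0" "8 / \<delta> \<le> 2 ^ m" and L: "L > 0" "8 / \<delta> \<le> (\<delta> / 3) ^ (2 * m) * 2 ^ L"
    and n: "54 * m / \<delta> \<le> n"
    and big: "32 / \<delta>\<^sup>2 \<le> card (bohr N \<Lambda> (\<kappa> ^ 4 / (512 * real n * real L) * \<rho>))"
  obtains A' \<Lambda>' \<rho>' where "ap3_free A'" "finite \<Lambda>'" "card \<Lambda>' \<le> card \<Lambda> + n" "regular N \<Lambda>' \<epsilon> \<kappa> \<rho>'"
    "\<kappa> ^ 4 / (512 * real n * real L) * \<rho> \<le> \<rho>'" "\<rho>' \<le> \<rho>"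
    "(1 + 1 / 512) * a * card (bohr N \<Lambda>' \<rho>') \<le> card (A' \<inter> bohr N \<Lambda>' \<rho>')"
proof -
  have N0: "N \<ge> 0" "N > 0" using N by auto
  have \<epsilon>0: "\<epsilon> \<ge> 0" using \<epsilon> by simp
  have \<kappa>: "0 < \<kappa>" "\<kappa> \<le> 1 / 4" unfolding t(2) using t(1) by (auto simp: field_simps)
  have "54 * m / \<delta> > 0" using m \<delta> by simp
  then have n0: "real n > 0" using n by linarith
  then have n1: "real n \<ge> 1" by simp
  have L1: "real L \<ge> 1" using L(1) by simp
  have bigpow: "(1 + \<epsilon>) ^ t > 81 ^ (k + 1)" if "k \<le> card \<Lambda> + n" for k
    using that by (intro le_less_trans[OF power_increasing t(3)]) auto
  note regular_scale = ex_regular[OF _ N0(2) \<epsilon>(1) t(1) bigpow, folded t(2)]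

  obtain \<rho>1 where \<rho>1: "\<kappa> * \<rho> / 2 \<le> \<rho>1" "\<rho>1 \<le> \<kappa> * \<rho>" and reg1: "regular N \<Lambda> \<epsilon> \<kappa> \<rho>1"
    using regular_scale[OF fin, of "\<kappa> * \<rho>"] \<kappa> \<rho> by auto
  have \<kappa>\<rho>: "0 < \<kappa> * \<rho>" "\<kappa> * \<rho> \<le> \<rho>" using \<kappa> \<rho> mult_right_mono[of \<kappa> 1 \<rho>] by simp_all
  have \<rho>1b: "0 < \<rho>1" "\<rho>1 \<le> \<rho>" "\<rho>1 \<le> 2" using \<rho>1 \<kappa>\<rho> \<rho> by linarith+
  have \<kappa>\<rho>1: "0 < \<kappa> * \<rho>1" "\<kappa> * \<rho>1 \<le> \<rho>1" using \<kappa> \<rho>1b mult_right_mono[of \<kappa> 1 \<rho>1] by simp_all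
  obtain \<rho>2 where \<rho>2: "\<kappa> * \<rho>1 / 2 / 2 \<le> \<rho>2" "\<rho>2 \<le> \<kappa> * \<rho>1 / 2" and reg2: "regular N \<Lambda> \<epsilon> \<kappa> \<rho>2"
    using regular_scale[OF fin, of "\<kappa> * \<rho>1 / 2"] \<kappa>\<rho>1 by auto
  have \<rho>2b: "0 < \<rho>2" "\<rho>2 \<le> \<rho>1" "\<rho>2 \<le> \<kappa> * \<rho>" "2 * \<rho>2 \<le> \<kappa> * \<rho>1" using \<rho>2 \<kappa>\<rho>1 \<rho>1 \<kappa>\<rho> \<rho>1b by linarith+
  have \<kappa>\<rho>2: "0 < \<kappa> * \<rho>2" "\<kappa> * \<rho>2 \<le> \<rho>2" using \<kappa> \<rho>2b mult_right_mono[of \<kappa> 1 \<rho>2] by simp_all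
  obtain \<rho>3 where \<rho>3: "\<kappa> * \<rho>2 / L / 2 \<le> \<rho>3" "\<rho>3 \<le> \<kappa> * \<rho>2 / L" and reg3: "regular N \<Lambda> \<epsilon> \<kappa> \<rho>3"
    using regular_scale[OF fin, of "\<kappa> * \<rho>2 / L"] \<kappa>\<rho>2 L by auto
  have \<rho>3b: "0 < \<rho>3" "L * \<rho>3 \<le> \<kappa> * \<rho>2"
    using \<rho>3 \<kappa>\<rho>2 L1 by (auto simp: field_simps intro: less_le_trans[of 0 "\<kappa> * \<rho>2 / L / 2"])
  have \<rho>3c: "\<rho>3 \<le> \<rho>2"
  proof -
    have "\<rho>3 \<le> L * \<rho>3" using L1 \<rho>3b by simp
    then show ?thesis using \<rho>3b \<kappa>\<rho>2 by linarith
  qed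
  have \<kappa>\<rho>3: "0 < \<kappa> * \<rho>3" "\<kappa> * \<rho>3 \<le> \<rho>3 / 4"
    using \<kappa> \<rho>3b mult_right_mono[OF \<kappa>(2), of \<rho>3] by auto
  \<comment> \<open>The factor n makes the total movement of n spanning frequencies small.\<close>
  define \<tau> where "\<tau> = \<kappa> * \<rho>3 / (16 * n)"
  have \<tau>: "0 < \<tau>" "n * \<tau> = \<kappa> * \<rho>3 / 16" using \<kappa>\<rho>3 n0 by (auto simp: \<tau>_def)
  have \<tau>_small: "\<tau> \<le> \<kappa> * \<rho>3 / 16"
  proof -
    have "1 * \<tau> \<le> n * \<tau>" using \<tau>(1) n1 by (intro mult_right_mono) auto
    then show ?thesis using \<tau>(2) by simp
  qed

  define \<kappa>' where "\<kappa>' = \<kappa> ^ 4 / (512 * real n * real L)"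
  have low: "\<kappa>' * \<rho> \<le> \<tau> / 2"
  proof -
    have "\<kappa> ^ 4 * \<rho> = \<kappa> ^ 3 * (\<kappa> * \<rho>)" by (simp add: power_numeral_reduce)
    also have "\<dots> \<le> \<kappa> ^ 3 * (2 * \<rho>1)" using \<rho>1 \<kappa> by (intro mult_left_mono) auto
    also have "\<dots> = 2 * \<kappa> ^ 2 * (\<kappa> * \<rho>1)" by (simp add: power_numeral_reduce)
    also have "\<dots> \<le> 2 * \<kappa> ^ 2 * (4 * \<rho>2)" using \<rho>2 \<kappa> by (intro mult_left_mono) auto
    also have "\<dots> = 8 * \<kappa> * (\<kappa> * \<rho>2)" by (simp add: power_numeral_reduce)
    also have "\<dots> \<le> 8 * \<kappa> * (2 * L * \<rho>3)"
      using \<rho>3(1) \<kappa> L1 by (intro mult_left_mono) (auto simp: field_simps)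
    finally have "\<kappa> ^ 4 * \<rho> \<le> 16 * L * (\<kappa> * \<rho>3)" by (simp add: mult_ac)
    then have "\<kappa> ^ 4 * \<rho> / (512 * real n * real L) \<le> 16 * L * (\<kappa> * \<rho>3) / (512 * real n * real L)"
      using n0 L1 by (intro divide_right_mono) auto
    also have "\<dots> = \<tau> / 2" using n0 L1 by (simp add: \<tau>_def field_simps)
    finally show ?thesis by (simp add: \<kappa>'_def)
  qed
  have low1: "\<kappa>' * \<rho> \<le> \<rho>1" "\<kappa>' * \<rho> \<le> \<rho>2"
    using low \<tau> \<tau>_small \<kappa>\<rho>3 \<rho>3c \<rho>2b by linarith+

  define B where "B = bohr N \<Lambda> \<rho>1"
  define B2 where "B2 = bohr N \<Lambda> \<rho>2"
  have posB: "card B > 0" "card B2 > 0"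
    unfolding B_def B2_def using card_bohr_pos \<rho>1b \<rho>2b N0 less_imp_le by metis+
  obtain u where u: "2 * (a - \<epsilon>) \<le> real (card {y\<in>B. u + y \<in> A}) / card B + real (card {y\<in>B2. u + y \<in> A}) / card B2"
    unfolding B_def B2_def using \<rho>1b \<rho>2b \<rho>1 \<rho> \<kappa> N0
    by (elim common_dense_translate[OF reg N0(1) _ \<epsilon>0 _ dens, rotated -1]) auto
  \<comment> \<open>From here on, A is recentred so that it is dense on two scales at once.\<close>
  define A1 where "A1 = {y. u + y \<in> A}"
  have free1: "ap3_free A1" using ap3_free_affine_preimage[OF free, of 1 u] by (simp add: A1_def)
  define \<alpha> where "\<alpha> = real (card (A1 \<inter> B)) / card B"
  define \<alpha>2 where "\<alpha>2 = real (card (A1 \<inter> B2)) / card B2"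
  have sets: "{y\<in>B. u + y \<in> A} = A1 \<inter> B" "{y\<in>B2. u + y \<in> A} = A1 \<inter> B2" by (auto simp: A1_def)
  have sum_dens: "2 * (a - \<epsilon>) \<le> \<alpha> + \<alpha>2" using u unfolding sets \<alpha>_def \<alpha>2_def .
  show thesis
  proof (cases "\<alpha> \<ge> (1 + 1 / 512) * a \<or> \<alpha>2 \<ge> (1 + 1 / 512) * a")
    case True
    then show thesis
    proof
      assume "\<alpha> \<ge> (1 + 1 / 512) * a"
      then have "(1 + 1 / 512) * a * card B \<le> card (A1 \<inter> B)"
        unfolding \<alpha>_def using posB by (simp only: pos_le_divide_eq of_nat_0_less_iff)
      then show thesis
        using that[of A1 \<Lambda> \<rho>1] free1 fin reg1 low1 \<rho>1b unfolding B_def \<kappa>'_def by simp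
    next
      assume "\<alpha>2 \<ge> (1 + 1 / 512) * a"
      then have "(1 + 1 / 512) * a * card B2 \<le> card (A1 \<inter> B2)"
        unfolding \<alpha>2_def using posB by (simp only: pos_le_divide_eq of_nat_0_less_iff)
      then show thesis
        using that[of A1 \<Lambda> \<rho>2] free1 fin reg2 low1 \<rho>1b \<rho>2b unfolding B2_def \<kappa>'_def by simp
    qed
  next
    case False
    then have \<alpha>low: "\<alpha> \<ge> (1 - 2 / 512) * a" and \<alpha>2low: "\<alpha>2 \<ge> (1 - 2 / 512) * a"
      using sum_dens \<epsilon> \<delta> by (auto simp: algebra_simps)
    have \<alpha>pos: "\<alpha> > 0" "\<alpha> \<ge> 3 / 4 * \<delta>" "\<alpha>2 \<ge> \<delta> / 2" "\<alpha>2 > 0" using \<alpha>low \<alpha>2low \<delta> by auto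
    define M where "M = nat \<lceil>12 * N\<rceil> + 1"
    have M: "real M > 12 * N" "real M > 8 * N" "M > 0" unfolding M_def using N0 by linarith+
    define A2 where "A2 = A1 \<inter> B2"
    have finA2: "finite A2" by (simp add: A2_def B2_def)
    have cA2: "real (card A2) = \<alpha>2 * card B2" using posB by (simp add: \<alpha>2_def A2_def)
    have cA2pos: "real (card A2) > 0" unfolding cA2 using \<alpha>pos posB by simp
    define f where "f x = of_bool (x \<in> A1) - \<alpha>" for x
    define F where "F j = (cmod (\<Sum>x\<in>B. of_real (f x) * cis (root_angle M j * x)))\<^sup>2" for j
    define S where "S j = (\<Sum>y\<in>A2. cis (2 * root_angle M j * y))" for j
    have "32 / \<delta>\<^sup>2 \<le> card B"
      using big card_bohr_mono[OF low1(1) N0(1), of \<Lambda>] unfolding B_def \<kappa>'_def by linarith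
    then have "32 \<le> \<delta>\<^sup>2 * card B" using \<delta> by (simp add: field_simps)
    moreover have "(\<delta> / 2)\<^sup>2 * card B \<le> \<alpha>\<^sup>2 * card B"
      using \<alpha>pos \<delta> by (intro mult_right_mono power_mono) auto
    ultimately have bigB: "8 \<le> \<alpha>\<^sup>2 * card B" by (simp add: power_divide)
    have mass: "\<alpha>\<^sup>2 / 2 * card B * card A2 * M \<le> (\<Sum>j<M. F j * cmod (S j))"
      using progression_free_fourier_mass[OF free1 reg1 N0(1) _ \<rho>1b(3) \<epsilon>0 _ _ \<rho>2b(4) _ M(2)]
        \<rho>1b \<rho>2b \<kappa> \<epsilon> \<alpha>pos \<delta> bigB
      unfolding F_def S_def f_def A2_def B_def B2_def \<alpha>_def by simp
    \<comment> \<open>Normalising the squared transform by W turns the mass bound into a correlation of the middle terms with a random frequency.\<close>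
    define W where "W = (\<Sum>j<M. F j)"
    have F0: "F j \<ge> 0" for j by (simp add: F_def)
    have S_le: "cmod (S j) \<le> card A2" for j
      unfolding S_def by (rule order.trans[OF norm_sum]) simp
    have W_upper: "W \<le> M * (\<alpha> * card B)"
    proof -
      have "W = M * (\<Sum>x\<in>B. (cmod (complex_of_real (f x)))\<^sup>2)"
        unfolding W_def F_def
      proof (rule parseval_ints[OF M(3)])
        show "finite B" by (simp add: B_def)
        fix x y assume "x \<in> B" "y \<in> B"
        then have "\<bar>real_of_int x\<bar> \<le> \<rho>1 * N" "\<bar>real_of_int y\<bar> \<le> \<rho>1 * N" by (auto simp: B_def bohr_def)
        moreover have "\<rho>1 * N \<le> 2 * N" using \<rho>1b N0 by (intro mult_right_mono) auto
        ultimately have "\<bar>real_of_int x\<bar> \<le> 2 * N" "\<bar>real_of_int y\<bar> \<le> 2 * N" by linarith+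
        then have "real_of_int \<bar>x - y\<bar> < real M" using M N unfolding of_int_abs of_int_diff by linarith
        then show "\<bar>x - y\<bar> < int M" by linarith
      qed
      also have "(\<Sum>x\<in>B. (cmod (complex_of_real (f x)))\<^sup>2) = (\<Sum>x\<in>B. (1 - 2 * \<alpha>) * of_bool (x \<in> A1) + \<alpha>\<^sup>2)"
        unfolding f_def norm_of_real power2_abs by (intro sum.cong refl) (auto simp: power2_eq_square algebra_simps)
      also have "\<dots> = (1 - 2 * \<alpha>) * card (A1 \<inter> B) + \<alpha>\<^sup>2 * card B"
        by (simp add: sum.distrib sum_distrib_left[symmetric] of_bool_def sum.If_cases B_def Int_def conj_commute)
      also have "real (card (A1 \<inter> B)) = \<alpha> * card B" using posB by (simp add: \<alpha>_def)
      also have "(1 - 2 * \<alpha>) * (\<alpha> * card B) + \<alpha>\<^sup>2 * card B = \<alpha> * card B - \<alpha>\<^sup>2 * card B"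
        by (simp add: algebra_simps power2_eq_square)
      also have "\<dots> \<le> \<alpha> * card B" by simp
      finally show ?thesis by (simp add: mult_left_mono)
    qed
    have "(\<Sum>j<M. F j * cmod (S j)) \<le> (\<Sum>j<M. F j * card A2)"
      by (intro sum_mono mult_left_mono S_le F0)
    then have "\<alpha>\<^sup>2 / 2 * card B * M * card A2 \<le> W * card A2"
      using mass unfolding W_def sum_distrib_right by (simp add: mult_ac)
    then have W_lower: "\<alpha>\<^sup>2 / 2 * card B * M \<le> W" using cA2pos by (simp only: mult_le_cancel_right_pos)
    have m0: "\<alpha>\<^sup>2 / 2 * card B * M > 0" using \<alpha>pos posB M by simp
    then have W0: "W > 0" using W_lower by linarith
    define \<eta> where "\<eta> = \<alpha>\<^sup>2 / 2 * card B * M / W"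
    have \<eta>1: "0 < \<eta>" "\<eta> \<le> 1" unfolding \<eta>_def using m0 W0 W_lower by auto
    have \<eta>_low: "\<delta> / 3 \<le> \<eta>"
    proof -
      have "\<alpha> / 2 * W \<le> \<alpha> / 2 * (M * (\<alpha> * card B))" using W_upper \<alpha>pos by (intro mult_left_mono) auto
      then have "\<alpha> / 2 \<le> \<eta>" unfolding \<eta>_def using W0 by (simp add: field_simps power2_eq_square)
      then show ?thesis using \<alpha>pos \<delta> by linarith
    qed
    define p where "p j = F j / W" for j
    define \<omega> where "\<omega> j = cnj (sgn (S j))" for j
    have corr: "\<eta> * card A2 \<le> cmod (\<Sum>y\<in>A2. \<Sum>j<M. of_real (p j) * \<omega> j * cis (2 * root_angle M j * y))"
    proof -
      have "(\<Sum>y\<in>A2. \<Sum>j<M. of_real (p j) * \<omega> j * cis (2 * root_angle M j * y))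
          = (\<Sum>j<M. of_real (p j) * (\<omega> j * S j))"
        by (subst sum.swap) (simp add: S_def sum_distrib_left mult.assoc)
      also have "\<dots> = complex_of_real (\<Sum>j<M. p j * cmod (S j))"
        by (simp add: \<omega>_def cnj_sgn_mult)
      finally have "cmod (\<Sum>y\<in>A2. \<Sum>j<M. of_real (p j) * \<omega> j * cis (2 * root_angle M j * y))
          = \<bar>\<Sum>j<M. p j * cmod (S j)\<bar>" by (simp only: norm_of_real)
      moreover have "\<eta> * card A2 \<le> (\<Sum>j<M. p j * cmod (S j))"
      proof -
        have "\<eta> * card A2 = (\<alpha>\<^sup>2 / 2 * card B * card A2 * M) / W" by (simp add: \<eta>_def)
        also have "\<dots> \<le> (\<Sum>j<M. F j * cmod (S j)) / W" using mass W0 by (intro divide_right_mono) auto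
        also have "\<dots> = (\<Sum>j<M. p j * cmod (S j))" by (simp add: p_def sum_divide_distrib)
        finally show ?thesis .
      qed
      ultimately show ?thesis by linarith
    qed
    \<comment> \<open>The smoothing enlarges the set of radius \<open>\<rho>2\<close> only to relative scale \<open>\<kappa>\<close>, where it is regular.\<close>
    have growth: "real (card (bohr N \<Lambda> (\<rho>2 + L * \<rho>3))) \<le> 4 / \<delta> * card A2"
    proof -
      have "real (card (bohr N \<Lambda> (\<rho>2 + L * \<rho>3))) \<le> card (bohr N \<Lambda> ((1 + \<kappa>) * \<rho>2))"
        using \<rho>3b N0 by (intro of_nat_mono card_bohr_mono) (auto simp: algebra_simps)
      also have "\<dots> \<le> (1 + \<epsilon>) * card (bohr N \<Lambda> ((1 - \<kappa>) * \<rho>2))" using reg2 by (simp add: regular_def)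
      also have "\<dots> \<le> (1 + \<epsilon>) * card B2"
        unfolding B2_def using \<epsilon> N0 \<kappa>\<rho>2 by (intro mult_left_mono of_nat_mono card_bohr_mono) (auto simp: left_diff_distrib)
      also have "\<dots> \<le> 2 * real (card B2)" using \<epsilon> \<delta> by (intro mult_right_mono) auto
      also have "\<dots> \<le> 4 / \<delta> * card A2"
      proof -
        have "\<delta> / 2 * card B2 \<le> card A2" unfolding cA2 using \<alpha>pos by (intro mult_right_mono) auto
        then show ?thesis using \<delta> by (simp add: field_simps)
      qed
      finally show ?thesis .
    qed
    obtain l \<theta> where l: "real l \<le> 18 * m / \<eta>" and
      conc: "(\<Sum>j\<in>{j\<in>{..<M}. almost_spanned (\<lambda>t. cmod (bohr_ft N \<Lambda> \<rho>3 t) > 1/2) l \<theta> (2 * root_angle M j)}. p j) > \<eta> / 18"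
    proof (rule concentrated_near_few_frequencies[where J = "{..<M}" and p = p and \<omega> = \<omega> and A = A2
          and \<psi> = "\<lambda>j. 2 * root_angle M j" and N = N and \<Lambda> = \<Lambda> and r = \<rho>2 and \<sigma> = \<rho>3 and \<eta> = \<eta>
          and K = "4 / \<delta>" and m = m and L = L])
      show "(\<Sum>j<M. p j) = 1" using W0 by (simp add: p_def sum_divide_distrib[symmetric] W_def)
      show "cmod (\<omega> j) \<le> 1" for j by (simp add: \<omega>_def norm_sgn)
      show "A2 \<subseteq> bohr N \<Lambda> \<rho>2" by (simp add: A2_def B2_def)
      show "A2 \<noteq> {}" using cA2pos by auto
      show "\<eta> * card A2 \<le> cmod (\<Sum>y\<in>A2. \<Sum>j<M. of_real (p j) * \<omega> j * cis (2 * root_angle M j * y))" by (rule corr)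
      show "real (card (bohr N \<Lambda> (\<rho>2 + L * \<rho>3))) \<le> 4 / \<delta> * card A2" by (rule growth)
      have "(\<delta> / 3) ^ (2 * m) * 2 ^ L \<le> \<eta> ^ (2 * m) * 2 ^ L"
        using \<eta>_low \<delta> by (intro mult_right_mono power_mono) auto
      then show "2 * (4 / \<delta>) \<le> \<eta> ^ (2 * m) * 2 ^ L" using L(2) by linarith
    qed (use \<delta> N0 \<rho>3b \<eta>1 F0 W0 m in \<open>auto simp: p_def\<close>)
    define D where "D = {j\<in>{..<M}. almost_spanned (\<lambda>t. cmod (bohr_ft N \<Lambda> \<rho>3 t) > 1/2) l \<theta> (2 * root_angle M j)}"
    have ln: "real l \<le> real n"
    proof -
      have "18 * m / \<eta> \<le> 18 * m / (\<delta> / 3)" using \<eta>_low \<delta> by (intro divide_left_mono) auto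
      then show ?thesis using l n by (simp add: mult.commute)
    qed
    define \<Lambda>' where "\<Lambda>' = \<Lambda> \<union> \<theta> ` {..<l}"
    have fin': "finite \<Lambda>'" using fin by (simp add: \<Lambda>'_def)
    have card': "card \<Lambda>' \<le> card \<Lambda> + n"
    proof -
      have "card \<Lambda>' \<le> card \<Lambda> + card (\<theta> ` {..<l})" unfolding \<Lambda>'_def by (rule card_Un_le)
      moreover have "card (\<theta> ` {..<l}) \<le> l" using card_image_le[of "{..<l}" \<theta>] by simp
      ultimately show ?thesis using ln by simp
    qed
    obtain \<rho>' where \<rho>': "\<tau> / 2 \<le> \<rho>'" "\<rho>' \<le> \<tau>" and reg': "regular N \<Lambda>' \<epsilon> \<kappa> \<rho>'"
      using regular_scale[OF fin' card' \<tau>(1)] by auto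
    define T where "T = bohr N \<Lambda>' \<rho>'"
    have \<rho>'0: "\<rho>' > 0" using \<rho>' \<tau> by linarith
    have T_sub: "T \<subseteq> bohr N \<Lambda> \<rho>'" unfolding T_def using N0 by (intro bohr_mono) (auto simp: \<Lambda>'_def)
    have posT: "card T > 0" unfolding T_def using card_bohr_pos \<rho>'0 N0 by simp
    \<comment> \<open>The spanning frequencies and the two negligible ones all hardly move on T, hence neither does any frequency in D.\<close>
    have near: "cmod (cis (2 * root_angle M j * y) - 1) \<le> 1 / 2" if j: "j \<in> D" and y: "y \<in> T" for j y
    proof -
      have "cmod (cis (2 * root_angle M j * y) - 1) \<le> l * \<rho>' + 2 * (2 * \<epsilon>)"
      proof (rule almost_spanned_close)
        show "almost_spanned (\<lambda>t. cmod (bohr_ft N \<Lambda> \<rho>3 t) > 1/2) l \<theta> (2 * root_angle M j)"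
          using j by (simp add: D_def)
        show "cmod (cis (\<theta> i * y) - 1) \<le> \<rho>'" if "i < l" for i
          using y that by (auto simp: T_def bohr_def \<Lambda>'_def)
        fix \<gamma> :: real assume "1/2 < cmod (bohr_ft N \<Lambda> \<rho>3 \<gamma>)"
        then have spec: "cmod (\<Sum>b\<in>bohr N \<Lambda> \<rho>3. cis (\<gamma> * real_of_int b)) > card (bohr N \<Lambda> \<rho>3) / 2"
          using card_bohr_pos[of \<rho>3 N \<Lambda>] \<rho>3b N0 by (simp add: bohr_ft_def norm_divide field_simps)
        have "y \<in> bohr N \<Lambda> (\<kappa> * \<rho>3)"
          using y T_sub bohr_mono[of \<rho>' "\<kappa> * \<rho>3" N \<Lambda> \<Lambda>] \<rho>' \<tau>_small \<kappa>\<rho>3 N0 by auto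
        then show "cmod (cis (\<gamma> * y) - 1) \<le> 2 * \<epsilon>"
          using \<rho>3b \<kappa> N0 \<epsilon>0 spec by (intro large_spectrum_nearly_trivial[OF reg3]) auto
      qed
      also have "l * \<rho>' \<le> n * \<tau>" using ln \<rho>' \<rho>'0 by (intro mult_mono) auto
      also have "n * \<tau> + 2 * (2 * \<epsilon>) \<le> 1 / 2"
        using \<tau>(2) \<kappa>\<rho>3 \<rho>3c \<rho>2b \<rho>1b \<epsilon> \<delta> by linarith
      finally show ?thesis by simp
    qed
    have D_large: "cmod (\<Sum>y\<in>T. cis (2 * root_angle M j * y)) \<ge> card T / 2" if j: "j \<in> D" for j
    proof -
      have "cmod (\<Sum>y\<in>T. cis (2 * root_angle M j * y) - 1) \<le> (\<Sum>y\<in>T. 1 / 2)"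
        by (rule order.trans[OF norm_sum]) (intro sum_mono near j)
      moreover have "(\<Sum>y\<in>T. cis (2 * root_angle M j * y) - 1) = (\<Sum>y\<in>T. cis (2 * root_angle M j * y)) - of_nat (card T)"
        by (simp add: sum_subtractf)
      ultimately show ?thesis
        using norm_triangle_ineq2[of "of_nat (card T) :: complex" "\<Sum>y\<in>T. cis (2 * root_angle M j * y)"]
        by (simp add: norm_minus_commute)
    qed
    have D_mass: "1 / 36 * \<alpha>\<^sup>2 * card B * M \<le> (\<Sum>j\<in>D. F j)"
    proof -
      have "\<eta> / 18 \<le> (\<Sum>j\<in>D. F j) / W"
        using conc by (simp add: D_def p_def sum_divide_distrib[symmetric])
      then have "\<eta> / 18 * W \<le> (\<Sum>j\<in>D. F j)" using W0 by (simp only: pos_le_divide_eq)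
      moreover have "\<eta> / 18 * W = 1 / 36 * \<alpha>\<^sup>2 * card B * M" using W0 by (simp add: \<eta>_def)
      ultimately show ?thesis by (simp only:)
    qed
    obtain v where v: "(\<alpha> * (1 + (1 / 36) / 4) - 2 * \<epsilon>) * card T \<le> card {y\<in>T. v + 2 * y \<in> A1}"
    proof (rule fourier_mass_density_increment[where A = A1 and T = T and D = D and M = M and c = "1/36"
          and N = N and \<Lambda> = \<Lambda> and \<rho> = \<rho>1 and \<epsilon> = \<epsilon> and \<kappa> = \<kappa>])
      show "regular N \<Lambda> \<epsilon> \<kappa> \<rho>1" by (rule reg1)
      show "finite T" "T \<noteq> {}" using posT by (auto simp: card_gt_0_iff)
      show "2 * y \<in> bohr N \<Lambda> (\<kappa> * \<rho>1 / 2)" if "y \<in> T" for y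
      proof -
        have "y \<in> bohr N \<Lambda> \<rho>'" using that T_sub by blast
        from bohr_add[OF this this] have "2 * y \<in> bohr N \<Lambda> (\<rho>' + \<rho>')" by simp
        moreover have "\<rho>' + \<rho>' \<le> \<kappa> * \<rho>1 / 2" using \<rho>' \<tau>_small \<kappa>\<rho>3 \<rho>3c \<rho>2b by linarith
        ultimately show ?thesis using bohr_mono[of _ _ N \<Lambda> \<Lambda>] N0 by blast
      qed
      show "\<bar>real_of_int y\<bar> \<le> 2 * N" if "y \<in> T" for y
      proof -
        have "\<bar>real_of_int y\<bar> \<le> \<rho>' * N" using that by (simp add: T_def bohr_def)
        also have "\<rho>' * N \<le> 2 * N"
          using \<rho>' \<tau>_small \<kappa>\<rho>3 \<rho>3c \<rho>2b \<rho>1b N0 by (intro mult_right_mono) linarith+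
        finally show ?thesis .
      qed
      show "D \<subseteq> {..<M}" by (auto simp: D_def)
      show "1 / 36 * (card (A1 \<inter> bohr N \<Lambda> \<rho>1) / card (bohr N \<Lambda> \<rho>1))\<^sup>2 * card (bohr N \<Lambda> \<rho>1) * M
         \<le> (\<Sum>j\<in>D. (cmod (\<Sum>x\<in>bohr N \<Lambda> \<rho>1. complex_of_real (of_bool (x \<in> A1)
               - card (A1 \<inter> bohr N \<Lambda> \<rho>1) / card (bohr N \<Lambda> \<rho>1)) * cis (root_angle M j * x)))\<^sup>2)"
        using D_mass unfolding F_def f_def \<alpha>_def B_def .
      show "0 < real (card (A1 \<inter> bohr N \<Lambda> \<rho>1)) / card (bohr N \<Lambda> \<rho>1)"
        using \<alpha>pos(1) unfolding \<alpha>_def B_def .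
    qed (use N0 \<rho>1b \<epsilon>0 \<kappa> M D_large in \<open>auto simp: \<alpha>_def B_def\<close>)
    define A' where "A' = {y. v + 2 * y \<in> A1}"
    have "(1 + 1 / 512) * a \<le> \<alpha> * (1 + (1 / 36) / 4) - 2 * \<epsilon>"
    proof -
      have "(1 - 2 / 512) * a * (1 + (1 / 36) / 4) \<le> \<alpha> * (1 + (1 / 36) / 4)"
        using \<alpha>low by (intro mult_right_mono) auto
      then show ?thesis using \<epsilon> \<delta> by simp
    qed
    then have "(1 + 1 / 512) * a * card T \<le> (\<alpha> * (1 + (1 / 36) / 4) - 2 * \<epsilon>) * card T"
      by (intro mult_right_mono) auto
    also note v
    also have "{y\<in>T. v + 2 * y \<in> A1} = A' \<inter> T" by (auto simp: A'_def)
    finally have inc: "(1 + 1 / 512) * a * card (bohr N \<Lambda>' \<rho>') \<le> card (A' \<inter> bohr N \<Lambda>' \<rho>')"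
      by (simp add: T_def)
    have free': "ap3_free A'" unfolding A'_def by (rule ap3_free_affine_preimage[OF free1]) simp
    have range: "\<kappa>' * \<rho> \<le> \<rho>'" "\<rho>' \<le> \<rho>"
      using low \<rho>' \<tau>_small \<kappa>\<rho>3 \<rho>3c \<rho>2b \<rho>1b by linarith+
    show thesis
      using that[OF free' fin' card' reg' _ _ inc] range unfolding \<kappa>'_def by blast
  qed
qed


section \<open>Iterating the increment\<close>

lemma power_ge_two:
  assumes "k > 0"
  shows "(1 + 1 / real k) ^ k \<ge> 2"
proof -
  have "-1 \<le> 1 / real k" by (rule order.trans[of _ 0]) auto
  from Bernoulli_inequality[OF this, of k] show ?thesis using assms by simp
qed

lemma Suc_le_two_power: "real q + 1 \<le> 2 ^ q"
  by (induction q) auto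

text \<open>
  The parameters of the iteration for sets of density at least \<open>2^-q\<close>, fixed once and for all in terms of this initial
  density. The density grows by the factor \<open>1 + 1 / 512\<close> in each step, hence doubles in at most 512 of them, and
  \<open>512 * (q + 1)\<close> steps would bring it above 1. The other values are those required by
  \<open>density_increment_step\<close> with \<open>\<delta> = 2^-q\<close> and \<open>\<epsilon> = 1 / eps_inv\<close>: \<open>moment\<close>, \<open>smoothings\<close> and \<open>rank_gain\<close> are its
  \<open>m\<close>, \<open>L\<close> and \<open>n\<close>, while \<open>scales\<close> is its \<open>t\<close>, large enough for regular radii to exist at the final rank.
\<close>

locale roth_parameters =
  fixes q :: nat
  assumes q: "q \<ge> 1"
begin

definition "steps = 512 * (q + 1)"
definition "moment = q + 3"
definition "smoothings = 2 * (q + 3) * (q + 2) + q + 3"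
definition "rank_gain = 54 * (q + 3) * 2 ^ q"
definition "eps_inv = (2 ^ (q + 14) :: nat)"
definition "scales = 7 * (steps * rank_gain + 1) * eps_inv"
definition "width = 1 / (4 * real scales)"
definition "shrink = width ^ 4 / (512 * real rank_gain * real smoothings)"

lemma eps_inv_pos: "eps_inv > 0" by (simp add: eps_inv_def)

lemma scales_pos: "scales > 0" by (simp add: scales_def eps_inv_pos)

lemma many_scales:
  assumes "k \<le> steps * rank_gain"
  shows "(1 + 1 / real eps_inv) ^ scales > 81 ^ (k + 1)"
proof -
  have "(81::real) ^ (k + 1) < 128 ^ (k + 1)" by (intro power_strict_mono) auto
  also have "\<dots> \<le> 128 ^ (steps * rank_gain + 1)" using assms by (intro power_increasing) auto
  also have "\<dots> = 2 ^ (7 * (steps * rank_gain + 1))" by (simp only: power_mult) simp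
  also have "\<dots> \<le> ((1 + 1 / real eps_inv) ^ eps_inv) ^ (7 * (steps * rank_gain + 1))"
    by (intro power_mono power_ge_two eps_inv_pos) auto
  also have "\<dots> = (1 + 1 / real eps_inv) ^ scales" by (simp add: scales_def power_mult[symmetric] mult_ac)
  finally show ?thesis .
qed

lemma rank_gain_pos: "rank_gain > 0" and smoothings_pos: "smoothings > 0"
  by (simp_all add: rank_gain_def smoothings_def)

lemma shrink_pos: "shrink > 0"
  using scales_pos rank_gain_pos smoothings_pos by (simp add: shrink_def width_def)

lemma shrink_le_1: "shrink \<le> 1"
proof -
  have "width ^ 4 \<le> 1" using scales_pos by (intro power_le_one) (auto simp: width_def)
  moreover have "1 \<le> 512 * real rank_gain * real smoothings"
  proof -
    have "1 \<le> 512 * rank_gain * smoothings" using rank_gain_pos smoothings_pos by (simp add: Suc_le_eq)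
    then have "real 1 \<le> real (512 * rank_gain * smoothings)" by (rule of_nat_mono)
    then show ?thesis by simp
  qed
  ultimately show ?thesis unfolding shrink_def by simp
qed

text \<open>
  All parameters are bounded by fixed powers of \<open>Q = 2^q\<close>, with deliberately wasteful exponents: only the
  order of magnitude of \<open>ln shrink\<close> matters.
\<close>

lemma shrink_lower: "1 \<le> shrink * 2 ^ (200 * q)"
proof -
  define Q :: real where "Q = 2 ^ q"
  have Q: "Q \<ge> 2" using power_increasing[of 1 q "2::real"] q by (simp add: Q_def)
  have QQ: "2 * Q \<le> Q * Q" using Q by (intro mult_right_mono) auto
  have qQ: "real q + 1 \<le> Q" using Suc_le_two_power by (simp add: Q_def)
  have two: "2 ^ k \<le> Q ^ k" for k using Q by (intro power_mono) auto
  have mono: "x \<le> Q ^ i \<Longrightarrow> i \<le> j \<Longrightarrow> x \<le> Q ^ j" for x i j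
    using power_increasing[of i j Q] Q by linarith
  have prod: "x \<le> Q ^ i \<Longrightarrow> y \<le> Q ^ j \<Longrightarrow> 0 \<le> y \<Longrightarrow> x * y \<le> Q ^ (i + j)" for x y i j
    unfolding power_add by (intro mult_mono) (use Q in auto)
  have st: "real steps \<le> Q ^ 10"
    using prod[of "2 ^ 9" 9 "real q + 1" 1] two[of 9] qQ by (simp add: steps_def)
  have rg: "real rank_gain \<le> Q ^ 10"
  proof -
    have "real q + 3 \<le> Q ^ 2" unfolding power2_eq_square using qQ Q QQ by linarith
    from prod[OF two[of 6] this] have "64 * (real q + 3) \<le> Q ^ 8" by simp
    moreover have "54 * (real q + 3) \<le> 64 * (real q + 3)" by simp
    ultimately have "54 * (real q + 3) \<le> Q ^ 8" by (rule order.trans[rotated])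
    from prod[OF this, of Q 1] show ?thesis using Q mono[of _ 9 10] by (simp add: rank_gain_def Q_def mult_ac)
  qed
  have sm: "real smoothings \<le> Q ^ 7"
  proof -
    have 1: "real q + 3 \<le> Q ^ 2" unfolding power2_eq_square using qQ Q QQ by linarith
    have "2 * Q + 3 \<le> 2 * (Q * Q)" using QQ Q by linarith
    also have "\<dots> \<le> Q * (Q * Q)" using Q by (intro mult_right_mono) auto
    also have "\<dots> = Q ^ 3" by (simp add: power_numeral_reduce)
    finally have 2: "2 * real q + 5 \<le> Q ^ 3" using qQ by linarith
    have "real smoothings = (real q + 3) * (2 * real q + 5)"
      by (simp add: smoothings_def algebra_simps)
    then show ?thesis using prod[OF 1 2] mono[of _ 5 7] by simp
  qed
  have ei: "real eps_inv \<le> Q ^ 15"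
    using prod[OF two[of 14], of Q 1] Q by (simp add: eps_inv_def Q_def power_add mult_ac)
  have "real steps * real rank_gain \<le> Q ^ 20" using prod[OF st rg] by simp
  then have "real steps * real rank_gain + 1 \<le> 2 * Q ^ 20"
    using two[of 20] by (simp add: algebra_simps)
  also have "\<dots> \<le> Q * Q ^ 20" using Q by (intro mult_right_mono) auto
  also have "\<dots> = Q ^ 21" by (simp only: power_Suc[symmetric]) simp
  finally have "real steps * real rank_gain + 1 \<le> Q ^ 21" .
  from prod[OF this ei] have "(real steps * real rank_gain + 1) * real eps_inv \<le> Q ^ 36" by simp
  from prod[OF two[of 5] this] have "32 * ((real steps * real rank_gain + 1) * real eps_inv) \<le> Q ^ 41" by simp
  moreover have "4 * real scales \<le> 32 * ((real steps * real rank_gain + 1) * real eps_inv)"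
    by (simp add: scales_def algebra_simps)
  ultimately have sc: "4 * real scales \<le> Q ^ 41" by (rule order.trans[rotated])
  have "(4 * real scales) ^ 4 \<le> (Q ^ 41) ^ 4" using sc by (intro power_mono) auto
  then have "(4 * real scales) ^ 4 \<le> Q ^ 164" by (simp add: power_mult[symmetric])
  moreover have "512 * real rank_gain * real smoothings \<le> Q ^ 26"
    using prod[OF prod[OF two[of 9] rg] sm] by simp
  ultimately have "(4 * real scales) ^ 4 * (512 * real rank_gain * real smoothings) \<le> Q ^ 190"
    using prod[of "(4 * real scales) ^ 4" 164 "512 * real rank_gain * real smoothings" 26] by simp
  also have "\<dots> \<le> Q ^ 200" using Q by (intro power_increasing) auto
  also have "\<dots> = 2 ^ (200 * q)" by (simp add: Q_def power_mult[symmetric] mult.commute)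
  finally have *: "(4 * real scales) ^ 4 * (512 * real rank_gain * real smoothings) \<le> 2 ^ (200 * q)" .
  have "shrink * ((4 * real scales) ^ 4 * (512 * real rank_gain * real smoothings)) = 1"
    using scales_pos rank_gain_pos smoothings_pos by (simp add: shrink_def width_def power_divide)
  then show ?thesis using mult_left_mono[OF *, of shrink] shrink_pos by simp
qed

text \<open>
  The hypothesis \<open>big\<close> says that no Bohr set met on the way is too small for the next step; it will be
  contradicted by running all \<open>steps\<close>, when the density would exceed 1.
\<close>

lemma iterated_density_increment:
  fixes A :: "int set" and N :: real
  assumes free: "ap3_free A" and N: "N \<ge> 1" and reg: "regular N {} (1 / eps_inv) width \<rho>" and \<rho>: "1 \<le> \<rho>" "\<rho> \<le> 2"
    and dens: "1 / 2 ^ q * card (bohr N {} \<rho>) \<le> card (A \<inter> bohr N {} \<rho>)"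
    and big: "\<And>\<Lambda> \<sigma>. finite \<Lambda> \<Longrightarrow> card \<Lambda> \<le> steps * rank_gain \<Longrightarrow> shrink ^ (steps + 1) \<le> \<sigma> \<Longrightarrow>
      32 * (2 ^ q)\<^sup>2 \<le> real (card (bohr N \<Lambda> \<sigma>))"
    and i: "i \<le> steps"
  shows "\<exists>A' \<Lambda> \<rho>'. ap3_free A' \<and> finite \<Lambda> \<and> card \<Lambda> \<le> i * rank_gain \<and> regular N \<Lambda> (1 / eps_inv) width \<rho>'
     \<and> shrink ^ i \<le> \<rho>' \<and> \<rho>' \<le> 2
     \<and> (1 + 1 / 512) ^ i * (1 / 2 ^ q) * card (bohr N \<Lambda> \<rho>') \<le> card (A' \<inter> bohr N \<Lambda> \<rho>')"
  using i
proof (induction i)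
  case 0
  then show ?case using free reg \<rho> dens by (intro exI[of _ A] exI[of _ "{}"] exI[of _ \<rho>]) auto
next
  case (Suc i)
  then obtain A' \<Lambda> \<rho>' where IH: "ap3_free A'" "finite \<Lambda>" "card \<Lambda> \<le> i * rank_gain"
    "regular N \<Lambda> (1 / eps_inv) width \<rho>'" "shrink ^ i \<le> \<rho>'" "\<rho>' \<le> 2"
    "(1 + 1 / 512) ^ i * (1 / 2 ^ q) * card (bohr N \<Lambda> \<rho>') \<le> card (A' \<inter> bohr N \<Lambda> \<rho>')"
    by auto
  define a where "a = (1 + 1 / 512) ^ i * (1 / 2 ^ q :: real)"
  have rank: "card \<Lambda> + rank_gain \<le> steps * rank_gain"
  proof -
    have "card \<Lambda> + rank_gain \<le> Suc i * rank_gain" using IH(3) by simp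
    also have "\<dots> \<le> steps * rank_gain" using Suc.prems by (intro mult_right_mono) auto
    finally show ?thesis .
  qed
  have shrink': "width ^ 4 / (512 * real rank_gain * real smoothings) = shrink" by (simp add: shrink_def)
  have scale: "shrink ^ Suc i \<le> shrink * \<rho>'" using IH(5) shrink_pos by simp
  have scale2: "shrink ^ (steps + 1) \<le> shrink * \<rho>'"
    using power_decreasing[of "Suc i" "steps + 1" shrink] shrink_pos shrink_le_1 Suc.prems scale by simp
  obtain A'' \<Lambda>'' \<rho>'' where new: "ap3_free A''" "finite \<Lambda>''" "card \<Lambda>'' \<le> card \<Lambda> + rank_gain"
    "regular N \<Lambda>'' (1 / eps_inv) width \<rho>''" "shrink * \<rho>' \<le> \<rho>''" "\<rho>'' \<le> \<rho>'"
    "(1 + 1 / 512) * a * card (bohr N \<Lambda>'' \<rho>'') \<le> card (A'' \<inter> bohr N \<Lambda>'' \<rho>'')"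
  proof (rule density_increment_step[OF IH(1) N IH(2,4), of a "1 / 2 ^ q" scales rank_gain moment smoothings,
        unfolded shrink'])
    show "0 < \<rho>'" using IH(5) shrink_pos by (meson less_le_trans zero_less_power)
    show "a * card (bohr N \<Lambda> \<rho>') \<le> card (A' \<inter> bohr N \<Lambda> \<rho>')" using IH(7) by (simp add: a_def)
    have "(1::real) \<le> (1 + 1 / 512) ^ i" by (intro one_le_power) auto
    then show "1 / 2 ^ q \<le> a" unfolding a_def by (simp add: field_simps)
    show "1 / real eps_inv \<le> 1 / 2 ^ q / 10000" by (simp add: eps_inv_def power_add field_simps)
    show "81 ^ (card \<Lambda> + rank_gain + 1) < (1 + 1 / real eps_inv) ^ scales" using many_scales[OF rank] .
    show "8 / (1 / 2 ^ q) \<le> (2::real) ^ moment" by (simp add: moment_def power_add)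
    show "real (54 * moment) / (1 / 2 ^ q) \<le> real rank_gain" by (simp add: moment_def rank_gain_def algebra_simps)
    show "32 / (1 / 2 ^ q)\<^sup>2 \<le> real (card (bohr N \<Lambda> (shrink * \<rho>')))"
      using big[OF IH(2) _ scale2] rank by (simp add: power_divide)
    show "8 / (1 / 2 ^ q) \<le> (1 / 2 ^ q / 3) ^ (2 * moment) * (2::real) ^ smoothings"
    proof -
      have "(1 / (4 * 2 ^ q)) ^ (2 * moment) \<le> (1 / 2 ^ q / 3 :: real) ^ (2 * moment)"
        by (intro power_mono) (auto simp: field_simps)
      then have "(1 / (4 * 2 ^ q)) ^ (2 * moment) * 2 ^ smoothings \<le> (1 / 2 ^ q / 3 :: real) ^ (2 * moment) * 2 ^ smoothings"
        by (intro mult_right_mono) auto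
      moreover have "(1 / (4 * 2 ^ q)) ^ (2 * moment) * (2::real) ^ smoothings = 8 * 2 ^ q"
      proof -
        have "(4 * 2 ^ q) ^ (2 * moment) = (2::real) ^ ((q + 2) * (2 * moment))"
          by (simp only: power_mult) (simp add: power_add mult.commute)
        moreover have "smoothings = (q + 2) * (2 * moment) + (q + 3)"
          by (simp add: smoothings_def moment_def algebra_simps)
        ultimately show ?thesis by (simp add: power_divide power_add)
      qed
      ultimately show ?thesis by simp
    qed
  qed (use IH scales_pos eps_inv_pos in \<open>auto simp: width_def moment_def smoothings_def\<close>)
  show ?case
  proof (intro exI conjI)
    show "card \<Lambda>'' \<le> Suc i * rank_gain" using new(3) IH(3) by simp
    show "shrink ^ Suc i \<le> \<rho>''" using scale new(5) by linarith
    show "\<rho>'' \<le> 2" using new(6) IH(6) by linarith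
    show "(1 + 1 / 512) ^ Suc i * (1 / 2 ^ q) * card (bohr N \<Lambda>'' \<rho>'') \<le> card (A'' \<inter> bohr N \<Lambda>'' \<rho>'')"
      using new(7) by (simp add: a_def mult.assoc)
  qed (rule new)+
qed

text \<open>
  By \<open>card_bohr_lower\<close>, a set of rank at most \<open>D\<close> and radius at least \<open>2 / 2^k\<close> has at least
  \<open>N / 81^((D + 1) k)\<close> elements. With \<open>D\<close> of order \<open>q\<^sup>2 2^q\<close> and \<open>k\<close> of order \<open>q\<^sup>2\<close> this is enough for every
  step, unless \<open>ln N\<close> is of order at most \<open>q^4 2^q\<close>. The factor 5 allows for the initial Bohr set, which is
  an interval of at most \<open>4 N + 1 \<le> 5 N\<close> integers around 0.
\<close>

lemma log_bound_of_dense_progression_free: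
  fixes A :: "int set" and N :: int
  assumes N: "N \<ge> 1" and A: "A \<subseteq> {1..N}" and free: "ap3_free A" and dens: "5 / 2 ^ q * N \<le> card A"
  shows "ln N \<le> 2 ^ 39 * real q ^ 4 * 2 ^ q"
proof -
  define k where "k = 200 * q * (steps + 1) + 1"
  define D where "D = steps * rank_gain"
  have N1: "real_of_int N \<ge> 1" using N by simp
  obtain \<rho> where \<rho>: "1 \<le> \<rho>" "\<rho> \<le> 2" and reg: "regular N {} (1 / eps_inv) width \<rho>"
    using ex_regular[of "{}" N "1 / eps_inv" scales 2] many_scales[of 0] eps_inv_pos scales_pos N1
    by (auto simp: width_def)
  have init: "1 / 2 ^ q * card (bohr N {} \<rho>) \<le> card (A \<inter> bohr N {} \<rho>)"
  proof -
    have "\<rho> * real_of_int N \<le> 2 * real_of_int N" using \<rho> N1 by (intro mult_right_mono) auto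
    then have "bohr N {} \<rho> \<subseteq> {- 2 * N..2 * N}" by (auto simp: bohr_def)
    then have "card (bohr N {} \<rho>) \<le> card {- 2 * N..2 * N}" by (intro card_mono) auto
    then have "real (card (bohr N {} \<rho>)) \<le> 5 * N" using N by simp
    then have "1 / 2 ^ q * card (bohr N {} \<rho>) \<le> 1 / 2 ^ q * (5 * N)" by (intro mult_left_mono) auto
    also have "\<dots> \<le> card A" using dens by simp
    also have "A \<inter> bohr N {} \<rho> = A"
    proof -
      have "1 * real_of_int N \<le> \<rho> * N" using \<rho> N1 by (intro mult_right_mono) auto
      moreover have "\<bar>real_of_int x\<bar> \<le> N" if "x \<in> A" for x using A that by auto
      ultimately have "A \<subseteq> bohr N {} \<rho>" by (force simp: bohr_def)
      then show ?thesis by blast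
    qed
    then have "card A = card (A \<inter> bohr N {} \<rho>)" by simp
    finally show ?thesis .
  qed
  have "real_of_int N \<le> 81 ^ ((D + 1) * k) * (32 * (2 ^ q)\<^sup>2)"
  proof (rule ccontr)
    assume large: "\<not> ?thesis"
    have big: "32 * (2 ^ q)\<^sup>2 \<le> real (card (bohr N \<Lambda> \<sigma>))"
      if "finite \<Lambda>" "card \<Lambda> \<le> D" "shrink ^ (steps + 1) \<le> \<sigma>" for \<Lambda> \<sigma>
    proof -
      have "(1::real) \<le> (shrink * 2 ^ (200 * q)) ^ (steps + 1)" using shrink_lower by (rule one_le_power)
      also have "\<dots> = shrink ^ (steps + 1) * 2 ^ (200 * q * (steps + 1))"
        by (simp only: power_mult_distrib power_mult)
      also have "\<dots> \<le> \<sigma> * 2 ^ (200 * q * (steps + 1))" using that(3) by (intro mult_right_mono) auto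
      finally have \<sigma>: "2 / 2 ^ k \<le> \<sigma>" by (simp add: k_def field_simps)
      have "real_of_int N \<le> 81 ^ ((card \<Lambda> + 1) * k) * real (card (bohr N \<Lambda> (2 / 2 ^ k)))"
        by (rule card_bohr_lower[OF that(1) N1])
      also have "\<dots> \<le> 81 ^ ((D + 1) * k) * real (card (bohr N \<Lambda> \<sigma>))"
        using that(2) \<sigma> N1 by (intro mult_mono power_increasing mult_right_mono of_nat_mono card_bohr_mono) auto
      finally have "81 ^ ((D + 1) * k) * (32 * (2 ^ q)\<^sup>2) < 81 ^ ((D + 1) * k) * real (card (bohr N \<Lambda> \<sigma>))"
        using large by linarith
      then show ?thesis by simp
    qed
    from iterated_density_increment[OF free N1 reg \<rho> init big[unfolded D_def] order.refl]
    obtain A' \<Lambda> \<rho>' where fin: "shrink ^ steps \<le> \<rho>'"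
      "(1 + 1 / 512) ^ steps * (1 / 2 ^ q) * card (bohr N \<Lambda> \<rho>') \<le> card (A' \<inter> bohr N \<Lambda> \<rho>')" by blast
    have "\<rho>' > 0" using fin(1) shrink_pos by (meson less_le_trans zero_less_power)
    then have pos: "real (card (bohr N \<Lambda> \<rho>')) > 0" using card_bohr_pos N1 by simp
    have "real (card (A' \<inter> bohr N \<Lambda> \<rho>')) \<le> 1 * card (bohr N \<Lambda> \<rho>')" by (simp add: card_mono)
    with fin(2) have "(1 + 1 / 512) ^ steps * (1 / 2 ^ q) * card (bohr N \<Lambda> \<rho>') \<le> 1 * real (card (bohr N \<Lambda> \<rho>'))"
      by linarith
    then have "(1 + 1 / 512) ^ steps * (1 / 2 ^ q) \<le> (1::real)" using pos by (simp only: mult_le_cancel_right_pos)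
    then have "(1 + 1 / 512) ^ steps \<le> (2::real) ^ q" by (simp add: field_simps)
    moreover have "(2::real) ^ (q + 1) \<le> (1 + 1 / 512) ^ steps"
    proof -
      have "(2::real) ^ (q + 1) \<le> ((1 + 1 / real 512) ^ 512) ^ (q + 1)"
        by (intro power_mono power_ge_two) auto
      then show ?thesis unfolding steps_def power_mult by simp
    qed
    moreover have "(2::real) ^ q < 2 ^ (q + 1)" by simp
    ultimately show False by linarith
  qed
  also have "\<dots> \<le> 128 ^ ((D + 1) * k) * (32 * (2 ^ q)\<^sup>2)" by (intro mult_right_mono power_mono) auto
  also have "\<dots> = 2 ^ (7 * ((D + 1) * k) + 5 + 2 * q)"
  proof -
    have "(128::real) ^ ((D + 1) * k) = 2 ^ (7 * ((D + 1) * k))" by (simp only: power_mult) simp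
    moreover have "32 * (2 ^ q)\<^sup>2 = (2::real) ^ (5 + 2 * q)"
      by (simp add: power_add power_mult[symmetric] mult.commute)
    ultimately show ?thesis by (simp add: power_add)
  qed
  finally have "ln N \<le> ln (2 ^ (7 * ((D + 1) * k) + 5 + 2 * q) :: real)" using N1 by (subst ln_le_cancel_iff) auto
  also have "\<dots> = real (7 * ((D + 1) * k) + 5 + 2 * q) * ln 2" by (rule ln_realpow)
  also have "\<dots> \<le> real (7 * ((D + 1) * k) + 5 + 2 * q) * 1"
    using ln_2_less_1 by (intro mult_left_mono) auto
  also have "\<dots> \<le> 2 ^ 39 * real q ^ 4 * 2 ^ q"
  proof -
    have q1: "real q \<ge> 1" using q by simp
    have P1: "(1::real) \<le> 2 ^ q" by simp
    have "real steps \<le> 1024 * real q" using q1 by (simp add: steps_def)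
    moreover have "real rank_gain \<le> 216 * real q * 2 ^ q" using q1 by (simp add: rank_gain_def)
    ultimately have "real D \<le> (1024 * real q) * (216 * real q * 2 ^ q)"
      unfolding D_def of_nat_mult by (intro mult_mono) auto
    then have "real D \<le> 221184 * (real q ^ 2 * 2 ^ q)" by (simp add: power2_eq_square mult_ac)
    moreover have q2: "1 \<le> real q ^ 2 * 2 ^ q"
      using mult_mono[of 1 "real q ^ 2" 1 "2 ^ q"] q1 P1 one_le_power[OF q1, of 2] by simp
    ultimately have D1: "real (D + 1) \<le> 2 ^ 18 * (real q ^ 2 * 2 ^ q)" by simp
    have "real k = 200 * real q * (real steps + 1) + 1" by (simp add: k_def distrib_left)
    also have "\<dots> \<le> 200 * real q * (1025 * real q) + 1 * real q * real q"
      using q1 mult_mono[OF q1 q1] by (intro add_mono mult_left_mono) (auto simp: steps_def)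
    also have "\<dots> \<le> 2 ^ 18 * real q ^ 2" by (simp add: power2_eq_square)
    finally have k1: "real k \<le> 2 ^ 18 * real q ^ 2" .
    have "real (D + 1) * real k \<le> (2 ^ 18 * (real q ^ 2 * 2 ^ q)) * (2 ^ 18 * real q ^ 2)"
      by (intro mult_mono D1 k1) auto
    also have "\<dots> = 2 ^ 36 * (real q ^ 4 * 2 ^ q)" by (simp add: power_numeral_reduce mult_ac)
    finally have "real ((D + 1) * k) \<le> 2 ^ 36 * (real q ^ 4 * 2 ^ q)" by (simp only: of_nat_mult)
    moreover have q4: "1 \<le> real q ^ 4 * 2 ^ q" "real q \<le> real q ^ 4 * 2 ^ q"
    proof -
      have "real q * 1 \<le> real q ^ 4 * 2 ^ q"
        using self_le_power[OF q1, of 4] P1 by (intro mult_mono) auto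
      then show "real q \<le> real q ^ 4 * 2 ^ q" by simp
      then show "1 \<le> real q ^ 4 * 2 ^ q" using q1 by linarith
    qed
    ultimately have "real (7 * ((D + 1) * k) + 5 + 2 * q) \<le> 2 ^ 39 * (real q ^ 4 * 2 ^ q)" by simp
    then show ?thesis by (simp add: mult.assoc)
  qed
  finally show ?thesis .
qed

end

section \<open>The bound for sets without progressions\<close>

text \<open>
  Here \<open>l\<close> is \<open>ln N\<close>. Densities below \<open>1 / l\<close> are harmless; otherwise \<open>2^q\<close> of order \<open>1 / \<alpha> \<le> l\<close> gives \<open>q\<close> of order \<open>ln l\<close>,
  and the bound on \<open>l\<close> becomes \<open>\<alpha> = O((ln l)^4 / l)\<close>. Since \<open>ln l / e \<ge> 1\<close> for the value \<open>e\<close> at \<open>N = 3\<close>, powers of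
  \<open>ln l / e\<close> absorb additive constants and raise the exponent to 5.
\<close>

lemma density_bound_of_log_bound:
  fixes \<alpha> l :: real
  assumes \<alpha>: "0 < \<alpha>" "\<alpha> \<le> 1" and l: "l \<ge> ln 3" and l3: "ln 3 > (1::real)"
    and bound: "\<And>q::nat. q \<ge> 1 \<Longrightarrow> 5 / 2 ^ q \<le> \<alpha> \<Longrightarrow> l \<le> 2 ^ 39 * real q ^ 4 * 2 ^ q"
  defines "e \<equiv> ln (ln (3::real))"
  shows "\<alpha> \<le> (2 ^ 39 * 10 * ((ln 10 / e + 1) / ln 2) ^ 4 / e + 1 / e ^ 5) * (ln l ^ 5 / l)"
proof -
  define c where "c = (ln 10 / e + 1) / ln (2::real)"
  have e: "e > 0" using l3 by (simp add: e_def)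
  have l1: "l > 1" using l l3 by linarith
  have ll: "e \<le> ln l" unfolding e_def using l l3 by (subst ln_le_cancel_iff) auto
  have ll0: "ln l > 0" using ll e by linarith
  have c0: "c \<ge> 0" using e by (simp add: c_def)
  show ?thesis
  proof (cases "\<alpha> \<le> 1 / l")
    case True
    have "1 \<le> (ln l / e) ^ 5" using ll e by (intro one_le_power) simp
    then have "1 / l \<le> (ln l / e) ^ 5 / l" using l1 by (intro divide_right_mono) auto
    also have "\<dots> = 1 / e ^ 5 * (ln l ^ 5 / l)" by (simp add: power_divide)
    also have "\<dots> \<le> (2 ^ 39 * 10 * c ^ 4 / e + 1 / e ^ 5) * (ln l ^ 5 / l)"
      using e c0 ll0 l1 by (intro mult_right_mono) auto
    finally show ?thesis using True unfolding c_def by linarith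
  next
    case False
    \<comment> \<open>The least q allowed in the bound on l.\<close>
    define q where "q = nat \<lceil>log 2 (5 / \<alpha>)\<rceil>"
    have log0: "log 2 (5 / \<alpha>) > 0" using \<alpha> by (subst zero_less_log_cancel_iff) auto
    have q1: "q \<ge> 1" using log0 unfolding q_def by linarith
    have qlow: "log 2 (5 / \<alpha>) \<le> q" and qup: "q \<le> log 2 (5 / \<alpha>) + 1"
      using log0 unfolding q_def by linarith+
    have "5 / \<alpha> = 2 powr (log 2 (5 / \<alpha>))" using \<alpha> by (simp add: powr_log_cancel)
    also have "\<dots> \<le> 2 powr q" using qlow by (intro powr_mono) auto
    finally have low: "5 / \<alpha> \<le> 2 ^ q" by (simp add: powr_realpow)
    have "2 powr q \<le> 2 powr (log 2 (5 / \<alpha>) + 1)" using qup by (intro powr_mono) auto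
    also have "\<dots> = 10 / \<alpha>" using \<alpha> by (simp add: powr_add powr_log_cancel)
    finally have up: "2 ^ q \<le> 10 / \<alpha>" by (simp add: powr_realpow)
    have "5 / 2 ^ q \<le> \<alpha>" using low \<alpha> by (simp add: field_simps)
    from bound[OF q1 this] have "l \<le> 2 ^ 39 * real q ^ 4 * 2 ^ q" .
    also have "\<dots> \<le> 2 ^ 39 * real q ^ 4 * (10 / \<alpha>)" by (intro mult_left_mono up) auto
    finally have a_le: "\<alpha> \<le> 2 ^ 39 * 10 * real q ^ 4 / l" using \<alpha> l1 by (simp add: field_simps)
    have "10 / \<alpha> \<le> 10 * l" using False \<alpha> l1 by (simp add: field_simps)
    with up have "2 ^ q \<le> 10 * l" by linarith
    then have "ln (2 ^ q) \<le> ln (10 * l)" using l1 by (subst ln_le_cancel_iff) auto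
    then have "real q * ln 2 \<le> ln 10 + ln l" using l1 by (simp add: ln_realpow ln_mult)
    also have "ln 10 \<le> ln 10 * (ln l / e)" using mult_left_mono[of 1 "ln l / e" "ln 10"] ll e by simp
    finally have "real q * ln 2 \<le> (ln 10 / e + 1) * ln l" by (simp add: algebra_simps)
    then have "real q \<le> c * ln l" by (simp add: c_def field_simps)
    then have "real q ^ 4 \<le> (c * ln l) ^ 4" by (intro power_mono) auto
    also have "\<dots> = c ^ 4 * ln l ^ 4 * 1" by (simp add: power_mult_distrib)
    also have "\<dots> \<le> c ^ 4 * ln l ^ 4 * (ln l / e)" using ll e by (intro mult_left_mono) auto
    finally have "real q ^ 4 \<le> c ^ 4 / e * ln l ^ 5" by (simp add: power_numeral_reduce mult_ac)
    then have "2 ^ 39 * 10 * real q ^ 4 / l \<le> 2 ^ 39 * 10 * (c ^ 4 / e * ln l ^ 5) / l"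
      using l1 by (intro divide_right_mono mult_left_mono) auto
    also have "\<dots> = 2 ^ 39 * 10 * c ^ 4 / e * (ln l ^ 5 / l)" by simp
    also have "\<dots> \<le> (2 ^ 39 * 10 * c ^ 4 / e + 1 / e ^ 5) * (ln l ^ 5 / l)"
      using e ll0 l1 by (intro mult_right_mono) auto
    finally show ?thesis using a_le unfolding c_def by linarith
  qed
qed

theorem theorem1p1:
  "\<exists>C::real. C > 0 \<and>
     (\<forall>(N::int) (A::int set). N \<ge> 3 \<longrightarrow> A \<subseteq> {1..N} \<longrightarrow> ap3_free A \<longrightarrow>
        real (card A) \<le> C * (real_of_int N * (ln (ln (real_of_int N))) ^ 5 / ln (real_of_int N)))"
proof -
  note l3 = ln3_gt_1
  define e where "e = ln (ln (3::real))"
  define C where "C = 2 ^ 39 * 10 * ((ln 10 / e + 1) / ln 2) ^ 4 / e + 1 / e ^ 5"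
  have e: "e > 0" using l3 by (simp add: e_def)
  have C: "C > 0" unfolding C_def using e by (intro add_nonneg_pos) auto
  show ?thesis
  proof (intro exI[of _ C] conjI allI impI C)
    fix N :: int and A :: "int set"
    assume N: "N \<ge> 3" and A: "A \<subseteq> {1..N}" and free: "ap3_free A"
    have N3: "real_of_int N \<ge> 3" using N by simp
    define \<alpha> where "\<alpha> = real (card A) / N"
    have cardA: "real (card A) = \<alpha> * N" using N3 by (simp add: \<alpha>_def)
    have l: "ln (real_of_int N) \<ge> ln 3" using N3 by simp
    have "e \<le> ln (ln (real_of_int N))" unfolding e_def using l l3 by (subst ln_le_cancel_iff) auto
    then have ll: "ln (ln (real_of_int N)) > 0" using e by linarith
    have "\<alpha> \<le> C * (ln (ln (real_of_int N)) ^ 5 / ln (real_of_int N))"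
    proof (cases "\<alpha> > 0")
      case True
      have "card A \<le> card {1..N}" using A by (intro card_mono) auto
      then have "\<alpha> \<le> 1" using N3 by (simp add: \<alpha>_def)
      moreover have "ln (real_of_int N) \<le> 2 ^ 39 * real q ^ 4 * 2 ^ q" if "q \<ge> 1" "5 / 2 ^ q \<le> \<alpha>" for q :: nat
      proof -
        interpret roth_parameters q by unfold_locales (rule that)
        have "5 / 2 ^ q * N \<le> card A" unfolding cardA using that(2) N3 by (intro mult_right_mono) auto
        then show ?thesis using N by (intro log_bound_of_dense_progression_free[OF _ A free]) auto
      qed
      ultimately show ?thesis
        unfolding C_def e_def using True l l3 by (intro density_bound_of_log_bound) auto
    next
      case False
      have "0 \<le> C * (ln (ln (real_of_int N)) ^ 5 / ln (real_of_int N))"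
        using C ll l l3 by (intro mult_nonneg_nonneg divide_nonneg_nonneg) auto
      then show ?thesis using False by linarith
    qed
    then have "\<alpha> * N \<le> C * (ln (ln (real_of_int N)) ^ 5 / ln (real_of_int N)) * N"
      using N3 by (intro mult_right_mono) auto
    then show "real (card A) \<le> C * (real_of_int N * (ln (ln (real_of_int N))) ^ 5 / ln (real_of_int N))"
      unfolding cardA by (simp add: mult_ac)
  qed
qed

end
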